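(* For every $t\ge1$ there are constants $0<\epsilon,\alpha<1$ depending only on $t$ such that the following holds. Let $P=\{p_1,\dots,p_N\}$ be an increasing sequence of $N$ distinct real numbers and let $E\subset\binom{P}{3}$ be a semi-algebraic relation of complexity at most $t$, given by $E^*=\{(x_1,x_2,x_3)\in\mathbb{R}^3:x_1<x_2<x_3,\ \Phi(f_1(x_1,x_2,x_3)\ge0,\dots,f_t(x_1,x_2,x_3)\ge0)=1\}$, such that $(P,E)$ has at most $r$ roots within its domain and $(P,E)$ is $K^{(3)}_s$-free. Then there is a subset $P'\subset P$ with $\binom{P'}{3}\cap E=\emptyset$ and $$|P'|\ge e^{\alpha^{\epsilon(r+s)}(\log N)^{\epsilon}}.$$
   Context: $\binom P3$ is the set of triples $(p_i,p_j,p_m)$ with $i<j<m$, and $(p_i,p_j,p_m)\in E$ iff $(p_i,p_j,p_m)\in E^*$; here $f_1,\dots,f_t$ are real polynomials in three variables of degree at most $t$ and $\Phi$ is a Boolean function (complexity at most $t$). The domain of $P$ is the open interval $(p_1,p_N)$. For $i<j$, $\mathcal{P}(p_i,p_j)$ is the set of nonzero univariate polynomials among $f_l(x,p_i,p_j)$, $f_l(p_i,x,p_j)$, $f_l(p_i,p_j,x)$ for $1\le l\le t$. $(P,E)$ has at most $r$ roots within its domain if for every pair $i<j$ the polynomials in $\mathcal{P}(p_i,p_j)$ have in total at most $r$ distinct real roots in $(p_1,p_N)$. $(P,E)$ is $K^{(3)}_s$-free if every $s$ points of $P$ contain a triple not in $E$. *)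

theory Defs
  imports Complex_Main "HOL-Library.Poly_Mapping" "HOL-Library.Product_Plus"
    "HOL-Computational_Algebra.Polynomial"
begin

text \<open>
  Real polynomials in three variables, as finitely supported coefficient functions:
  the key \<open>(i, j, k)\<close> stands for the monomial \<open>x\<^sub>1 ^ i * x\<^sub>2 ^ j * x\<^sub>3 ^ k\<close>.
\<close>
type_synonym poly3 = "(nat \<times> nat \<times> nat) \<Rightarrow>\<^sub>0 real"

definition total_degree3 :: "poly3 \<Rightarrow> nat" where
  "total_degree3 f = Max (insert 0 ((\<lambda>(i, j, k). i + j + k) ` Poly_Mapping.keys f))"

text \<open>
  Substitution of elements of a commutative ring for the three variables; \<open>c\<close> is the map
  that embeds the real coefficients into that ring.
\<close>
definition subst3 :: "(real \<Rightarrow> 'a::comm_ring_1) \<Rightarrow> poly3 \<Rightarrow> 'a \<Rightarrow> 'a \<Rightarrow> 'a \<Rightarrow> 'a" where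
  "subst3 c f u v w =
     (\<Sum>(i, j, k)\<in>Poly_Mapping.keys f. c (Poly_Mapping.lookup f (i, j, k)) * u ^ i * v ^ j * w ^ k)"

definition eval3 :: "poly3 \<Rightarrow> real \<Rightarrow> real \<Rightarrow> real \<Rightarrow> real" where
  "eval3 f x y z = subst3 (\<lambda>a. a) f x y z"

definition subst3_poly :: "poly3 \<Rightarrow> real poly \<Rightarrow> real poly \<Rightarrow> real poly \<Rightarrow> real poly" where
  "subst3_poly f u v w = subst3 (\<lambda>a. [:a:]) f u v w"

lemma poly_subst3_poly:
  "poly (subst3_poly f u v w) x = eval3 f (poly u x) (poly v x) (poly w x)"
  by (simp add: subst3_poly_def eval3_def subst3_def poly_sum case_prod_unfold mult.assoc)

definition triples :: "real set \<Rightarrow> (real \<times> real \<times> real) set" where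
  "triples P = {(x, y, z). x \<in> P \<and> y \<in> P \<and> z \<in> P \<and> x < y \<and> y < z}"

text \<open>
  The set \<open>E\<^sup>*\<close>. The polynomials are \<open>f 1, \<dots>, f t\<close>. The Boolean function \<open>\<Phi>\<close> of \<open>t\<close> arguments
  takes them as a list of length \<open>t\<close>; its values on other lists are never used.
\<close>
definition semialg3 ::
  "nat \<Rightarrow> (nat \<Rightarrow> poly3) \<Rightarrow> (bool list \<Rightarrow> bool) \<Rightarrow> (real \<times> real \<times> real) set" where
  "semialg3 t f \<Phi> =
     {(x, y, z). x < y \<and> y < z \<and> \<Phi> (map (\<lambda>l. eval3 (f l) x y z \<ge> 0) [1..<t + 1])}"

definition semialgebraic_relation ::
  "nat \<Rightarrow> (nat \<Rightarrow> poly3) \<Rightarrow> (bool list \<Rightarrow> bool) \<Rightarrow> real set \<Rightarrow> (real \<times> real \<times> real) set \<Rightarrow> bool" where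
  "semialgebraic_relation t f \<Phi> P E \<longleftrightarrow>
     (\<forall>l\<in>{1..t}. total_degree3 (f l) \<le> t) \<and>
     E \<subseteq> triples P \<and> (\<forall>\<tau>\<in>triples P. \<tau> \<in> E \<longleftrightarrow> \<tau> \<in> semialg3 t f \<Phi>)"

text \<open>Here \<open>[:0, 1:]\<close> is the free variable \<open>x\<close>, and \<open>[:a:]\<close>, \<open>[:b:]\<close> are constants.\<close>
definition pair_polys :: "nat \<Rightarrow> (nat \<Rightarrow> poly3) \<Rightarrow> real \<Rightarrow> real \<Rightarrow> real poly set" where
  "pair_polys t f a b =
     (\<Union>l\<in>{1..t}. {subst3_poly (f l) [:0, 1:] [:a:] [:b:],
                   subst3_poly (f l) [:a:] [:0, 1:] [:b:],
                   subst3_poly (f l) [:a:] [:b:] [:0, 1:]}) - {0}"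

definition at_most_roots_in_domain ::
  "nat \<Rightarrow> (nat \<Rightarrow> poly3) \<Rightarrow> nat \<Rightarrow> (nat \<Rightarrow> real) \<Rightarrow> nat \<Rightarrow> bool" where
  "at_most_roots_in_domain t f N p r \<longleftrightarrow>
     (\<forall>i\<in>{1..N}. \<forall>j\<in>{1..N}. i < j \<longrightarrow>
        card {x \<in> {p 1<..<p N}. \<exists>g\<in>pair_polys t f (p i) (p j). poly g x = 0} \<le> r)"

text \<open>The set of roots counted above is finite, so its \<open>card\<close> is meaningful.\<close>
lemma finite_pair_polys_roots:
  "finite {x \<in> A. \<exists>g\<in>pair_polys t f a b. poly g x = 0}"
proof -
  have "finite (\<Union>g\<in>pair_polys t f a b. {x. poly g x = 0})"
    unfolding pair_polys_def by (intro finite_UN_I) (auto intro: poly_roots_finite)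
  then show ?thesis
    by (rule rev_finite_subset) auto
qed

definition K3_free :: "real set \<Rightarrow> (real \<times> real \<times> real) set \<Rightarrow> nat \<Rightarrow> bool" where
  "K3_free P E s \<longleftrightarrow> (\<forall>S \<subseteq> P. card S = s \<longrightarrow> (\<exists>\<tau>\<in>triples S. \<tau> \<notin> E))"

end

theory Submission
  imports Defs "HOL-Library.FuncSet"
begin

text \<open>
  Colour a triple by the signs of all mixed partial derivatives of the polynomials at it. This is a
  bounded number \<open>K\<close> of colours, and by Thom's lemma each colour class is convex in each coordinate
  when the other two are fixed. Only this property is used from here on; the degrees alone bound the
  number of roots, so the parameter \<open>r\<close> merely weakens the conclusion.

  For a pair colouring that is convex in one coordinate, halving arguments give monochromatic sets
  of polynomial size. Given nested intervals around a short block, colour the pairs of the block by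
  their colours with the endpoints of the intervals. By convexity a pair takes equal colours at two
  consecutive endpoints for all but \<open>2 K\<close> of the shells, and then it sees the whole shell in one
  colour. So a polynomially large part of the block sees one shell in one colour on either side.
  Descending a tree of blocks produces many blocks inside a common shell, and a counting argument
  selects polynomially many of them whose transversal triples have a colour depending on the blocks only.

  If some pair colour is an edge colour, then a block has one clique size less, at the cost of
  replacing \<open>log N\<close> by \<open>c log N\<close>. Otherwise an independent set of representatives can be combined with
  independent sets inside the blocks, and \<open>F(N) \<ge> F(N^c)^2\<close> for the guaranteed size \<open>F\<close>,
  which gives \<open>exp ((log N)^\<epsilon>)\<close> with \<open>c^\<epsilon> = 1/2\<close>.
\<close>

subsection \<open>Convex colourings of pairs\<close>

definition convex_coloring :: "('a::linorder \<Rightarrow> 'c) \<Rightarrow> bool" where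
  "convex_coloring g \<longleftrightarrow> (\<forall>x u y. x \<le> u \<longrightarrow> u \<le> y \<longrightarrow> g x = g y \<longrightarrow> g u = g x)"

lemma convex_coloringD:
  "convex_coloring g \<Longrightarrow> x \<le> u \<Longrightarrow> u \<le> y \<Longrightarrow> g x = g y \<Longrightarrow> g u = g x"
  unfolding convex_coloring_def by blast

text \<open>In each nonconstant block pick two points of different colours and record the colour of
  the larger one. If a later block recorded the same colour, its smaller point would lie between two
  equally coloured points, against convexity. So the recorded colours are distinct. The blocks are
  only weakly ordered, so that neighbours may share an endpoint.\<close>

lemma card_nonconstant_blocks:
  fixes g :: "'a::linorder \<Rightarrow> 'c"
  assumes g: "convex_coloring g" and C: "finite C" "range g \<subseteq> C"
    and B: "\<And>i j. i \<in> I \<Longrightarrow> j \<in> I \<Longrightarrow> i \<noteq> j \<Longrightarrow>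
      (\<forall>x\<in>B i. \<forall>y\<in>B j. x \<le> y) \<or> (\<forall>x\<in>B i. \<forall>y\<in>B j. y \<le> x)"
  shows "card {i\<in>I. \<exists>x\<in>B i. \<exists>y\<in>B i. g x \<noteq> g y} \<le> card C"
proof -
  let ?S = "{i\<in>I. \<exists>x\<in>B i. \<exists>y\<in>B i. g x \<noteq> g y}"
  have "\<forall>i\<in>?S. \<exists>p. fst p \<in> B i \<and> snd p \<in> B i \<and> fst p < snd p \<and> g (fst p) \<noteq> g (snd p)"
  proof
    fix i assume "i \<in> ?S"
    then obtain x y where xy: "x \<in> B i" "y \<in> B i" "g x \<noteq> g y" by blast
    show "\<exists>p. fst p \<in> B i \<and> snd p \<in> B i \<and> fst p < snd p \<and> g (fst p) \<noteq> g (snd p)"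
    proof (cases "x < y")
      case True
      then show ?thesis using xy by (intro exI[of _ "(x, y)"]) simp
    next
      case False
      then have "y < x" using xy by (metis linorder_neqE)
      then show ?thesis using xy by (intro exI[of _ "(y, x)"]) simp
    qed
  qed
  from bchoice[OF this] obtain p where p: "\<forall>i\<in>?S.
      fst (p i) \<in> B i \<and> snd (p i) \<in> B i \<and> fst (p i) < snd (p i) \<and> g (fst (p i)) \<noteq> g (snd (p i))"
    by (elim exE) (rule that)
  have key: False
    if "i \<in> ?S" "j \<in> ?S" "\<forall>x\<in>B i. \<forall>y\<in>B j. x \<le> y" "g (snd (p i)) = g (snd (p j))" for i j
    using convex_coloringD[OF g, of "snd (p i)" "fst (p j)" "snd (p j)"] bspec[OF p that(1)] bspec[OF p that(2)] that(3,4)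
    by (auto intro: less_imp_le)
  have inj: "inj_on (\<lambda>i. g (snd (p i))) ?S"
  proof (rule inj_onI, rule ccontr)
    fix i j assume *: "i \<in> ?S" "j \<in> ?S" "g (snd (p i)) = g (snd (p j))" "i \<noteq> j"
    then consider "\<forall>x\<in>B i. \<forall>y\<in>B j. x \<le> y" | "\<forall>x\<in>B j. \<forall>y\<in>B i. x \<le> y"
      using B[of i j] by blast
    then show False using key[of i j] key[of j i] * by cases auto
  qed
  have sub: "(\<lambda>i. g (snd (p i))) ` ?S \<subseteq> C" using C by auto
  show "card ?S \<le> card C" using card_inj_on_le[OF inj sub C(1)] .
qed

text \<open>Past the last index the enumeration is continued by its last value. Being monotone on
  all naturals, it pulls convex colourings back to convex colourings.\<close>

lemma finite_linorder_enum:
  fixes X :: "'a::linorder set"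
  assumes "finite X" "X \<noteq> {}"
  obtains e :: "nat \<Rightarrow> 'a"
  where "mono e" "strict_mono_on {..<card X} e" "e ` {..<card X} = X"
proof -
  let ?l = "sorted_list_of_set X"
  define e where "e i = ?l ! min i (card X - 1)" for i
  have len: "length ?l = card X" by simp
  have pos: "card X > 0" using assms by (simp add: card_gt_0_iff)
  have "mono e"
    unfolding e_def by (intro monoI sorted_nth_mono) (use pos in auto)
  moreover have "strict_mono_on {..<card X} e"
  proof (rule strict_mono_onI)
    fix r s assume "r \<in> {..<card X}" "s \<in> {..<card X}" "r < s"
    then have "e r = ?l ! r" "e s = ?l ! s" "?l ! r < ?l ! s"
      using sorted_wrt_nth_less[OF strict_sorted_list_of_set[of X], of r s]
      by (auto simp: e_def min_def)
    then show "e r < e s" by simp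
  qed
  moreover have "e ` {..<card X} = set ?l"
    unfolding set_conv_nth len by (force simp: e_def min_def image_iff)
  ultimately show ?thesis using that assms by auto
qed

text \<open>The upper half of \<open>X\<close> is cut into \<open>K + 1\<close> consecutive blocks.
  By convexity every point of the lower half sees at least one block in a single colour. Pigeonhole
  over the pairs of a block and a colour yields \<open>A\<close>, and \<open>B\<close> is the
  block.\<close>

lemma homogeneous_bipartite:
  fixes X :: "'a::linorder set" and g :: "'a \<Rightarrow> 'a \<Rightarrow> 'c"
  assumes X: "finite X" and C: "finite C" "card C \<le> K" "\<And>x y. g x y \<in> C"
    and g: "\<And>x. convex_coloring (g x)"
    and large: "card X \<ge> 4 * (K + 1)\<^sup>2"
  obtains A B \<kappa> where "A \<subseteq> X" "B \<subseteq> X" "\<kappa> \<in> C" "card X \<le> 4 * (K + 1)\<^sup>2 * card A"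
    "card X \<le> 4 * (K + 1)\<^sup>2 * card B" "\<And>x y. x \<in> A \<Longrightarrow> y \<in> B \<Longrightarrow> x < y \<and> g x y = \<kappa>"
proof -
  define N where "N = card X"
  define b where "b = N div (2 * (K + 1))"
  have "X \<noteq> {}" using large by auto
  then obtain e where e: "mono e" "strict_mono_on {..<N} e" "e ` {..<N} = X"
    using finite_linorder_enum[OF X] unfolding N_def by blast
  have b1: "2 * ((K + 1) * b) \<le> N"
    unfolding b_def using times_div_less_eq_dividend[of "2 * (K + 1)" N] by (simp only: mult.assoc)
  have N4: "N \<ge> 4 * (K + 1)" using large unfolding N_def power2_eq_square by (rule order.trans[rotated]) simp
  have b2: "N \<le> 4 * ((K + 1) * b)"
  proof -
    have "N < 2 * (K + 1) * b + 2 * (K + 1)" unfolding b_def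
      using dividend_less_times_div[of "2 * (K + 1)" N] by simp
    then show ?thesis using N4 by (simp add: algebra_simps)
  qed
  \<comment> \<open>The remainder of the division goes to the lower part, so the last of the
    \<open>K + 1\<close> blocks ends exactly at index \<open>N\<close>.\<close>
  define s where "s = N - (K + 1) * b"
  define Bl where "Bl i = e ` {s + i * b..<s + (i + 1) * b}" for i
  have sub: "s + (i + 1) * b \<le> N" if "i \<le> K" for i
  proof -
    have "(i + 1) * b \<le> (K + 1) * b" using that by (intro mult_right_mono) auto
    then show ?thesis using b1 unfolding s_def by linarith
  qed
  have "\<exists>i\<in>{..K}. \<exists>c\<in>C. \<forall>y\<in>Bl i. g x y = c" for x
  proof (rule ccontr)
    assume no: "\<not> ?thesis"
    have *: "{i\<in>{..K}. \<exists>u\<in>Bl i. \<exists>v\<in>Bl i. g x u \<noteq> g x v} = {..K}" (is "?S = _")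
    proof -
      have "\<exists>u\<in>Bl i. \<exists>v\<in>Bl i. g x u \<noteq> g x v" if "i \<le> K" for i
      proof (rule ccontr)
        assume "\<not> ?thesis"
        then have "\<exists>c\<in>C. \<forall>y\<in>Bl i. g x y = c"
          using C(3) by (cases "Bl i = {}") blast+
        then show False using no that by blast
      qed
      then show ?thesis by blast
    qed
    have "card ?S \<le> card C"
    proof (rule card_nonconstant_blocks[OF g C(1)])
      show "range (g x) \<subseteq> C" using C by auto
      have **: "\<forall>u\<in>Bl i. \<forall>v\<in>Bl j. u \<le> v" if "i < j" for i j
      proof -
        have "(i + 1) * b \<le> j * b" using that by (intro mult_right_mono) auto
        then show ?thesis unfolding Bl_def by (auto intro!: monoD[OF e(1)])
      qed
      show "(\<forall>u\<in>Bl i. \<forall>v\<in>Bl j. u \<le> v) \<or> (\<forall>u\<in>Bl i. \<forall>v\<in>Bl j. v \<le> u)" if "i \<noteq> j" for i j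
        using that **[of i j] **[of j i] by (cases i j rule: linorder_cases) auto
    qed
    then show False using * C(2) by simp
  qed
  then obtain \<iota> \<gamma> where ig: "\<And>x. \<iota> x \<in> {..K} \<and> \<gamma> x \<in> C \<and> (\<forall>y\<in>Bl (\<iota> x). g x y = \<gamma> x)"
    by metis
  let ?L = "e ` {..<s}" and ?h = "\<lambda>x. (\<iota> x, \<gamma> x)"
  have injs: "inj_on e {..<N}" by (rule strict_mono_on_imp_inj_on[OF e(2)])
  have "card ?L = s" 
    by (subst card_image) (auto intro: inj_on_subset[OF injs] simp: s_def)
  have Cne: "C \<noteq> {}" using C(3) by auto
  have "\<exists>p\<in>{..K} \<times> C. card ?L \<le> card ({..K} \<times> C) * card (?h -` {p} \<inter> ?L)"
  proof (rule ccontr)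
    assume "\<not> ?thesis"
    then have lt: "\<And>p. p \<in> {..K} \<times> C \<Longrightarrow> card ({..K} \<times> C) * card (?h -` {p} \<inter> ?L) < card ?L" by force
    have "card ?L = card (\<Union>p\<in>{..K} \<times> C. ?h -` {p} \<inter> ?L)"
      using ig by (intro arg_cong[where f = card]) auto
    also have "\<dots> \<le> (\<Sum>p\<in>{..K} \<times> C. card (?h -` {p} \<inter> ?L))"
      by (intro card_UN_le) (use C in auto)
    finally have "card ({..K} \<times> C) * card ?L \<le> (\<Sum>p\<in>{..K} \<times> C. card ({..K} \<times> C) * card (?h -` {p} \<inter> ?L))"
      by (simp add: sum_distrib_left[symmetric])
    also have "\<dots> < (\<Sum>p\<in>{..K} \<times> C. card ?L)"
      by (intro sum_strict_mono lt) (use C Cne in auto)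
    finally show False by simp
  qed
  then obtain i c where ic: "i \<le> K" "c \<in> C"
    "card ?L \<le> card ({..K} \<times> C) * card (?h -` {(i, c)} \<inter> ?L)" by auto
  define A where "A = ?h -` {(i, c)} \<inter> ?L"
  have cB: "card (Bl i) = b" unfolding Bl_def
    by (subst card_image) (use sub[OF ic(1)] in \<open>auto intro: inj_on_subset[OF injs]\<close>)
  show ?thesis
  proof (rule that[of A "Bl i" c])
    show "A \<subseteq> X" unfolding A_def using e(3) by (auto simp: s_def)
    show "Bl i \<subseteq> X" unfolding Bl_def using e(3) sub[OF ic(1)] by auto
    show "c \<in> C" by fact
    have "s \<le> (K + 1) * (K + 1) * card A"
    proof -
      have "card ({..K} \<times> C) \<le> (K + 1) * (K + 1)" 
        unfolding card_cartesian_product using C(2) by (intro mult_mono) auto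
      then have "card ({..K} \<times> C) * card A \<le> (K + 1) * (K + 1) * card A" by (rule mult_right_mono) simp
      then show ?thesis using ic(3) \<open>card ?L = s\<close> unfolding A_def by linarith
    qed
    moreover have "N \<le> 2 * s" using b1 unfolding s_def by linarith
    ultimately show "card X \<le> 4 * (K + 1)\<^sup>2 * card A" unfolding N_def power2_eq_square by linarith
    have "(K + 1) * b \<le> (K + 1) * (K + 1) * b" by simp
    then show "card X \<le> 4 * (K + 1)\<^sup>2 * card (Bl i)"
      using b2 cB unfolding N_def power2_eq_square by (simp add: algebra_simps)
    show "x < y \<and> g x y = c" if "x \<in> A" "y \<in> Bl i" for x y
    proof -
      obtain u where u: "x = e u" "u < s" "\<iota> x = i" "\<gamma> x = c" using \<open>x \<in> A\<close> unfolding A_def by auto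
      obtain v where v: "y = e v" "s + i * b \<le> v" "v < s + (i + 1) * b"
        using \<open>y \<in> Bl i\<close> unfolding Bl_def by auto
      have "u < v" "v < N" using u v sub[OF ic(1)] by auto
      then have "x < y" unfolding u(1) v(1) by (intro strict_mono_onD[OF e(2)]) auto
      moreover have "g x y = c" using ig[of x] u that by auto
      ultimately show ?thesis by simp
    qed
  qed
qed

text \<open>
  The product over all colours of the monochromatic sizes is superadditive on a homogeneous pair
  \<open>(A, B)\<close>: the sizes add in the colour of the pair and are at least the maximum in the others.
\<close>
lemma homogeneous_product:
  fixes X :: "'a::linorder set" and g :: "'a \<Rightarrow> 'a \<Rightarrow> 'c"
  assumes X: "finite X" "X \<noteq> {}" and C: "finite C" "card C \<le> K" "\<And>x y. g x y \<in> C"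
    and g: "\<And>x. convex_coloring (g x)"
  shows "\<exists>J. (\<forall>c\<in>C. J c \<subseteq> X \<and> J c \<noteq> {} \<and> (\<forall>x\<in>J c. \<forall>y\<in>J c. x < y \<longrightarrow> g x y = c)) \<and>
    real (card X) powr (log (4 * (real K + 1)\<^sup>2) 2) \<le> (\<Prod>c\<in>C. real (card (J c)))"
proof -
  define good where "good X J \<longleftrightarrow> (\<forall>c\<in>C. J c \<subseteq> X \<and> J c \<noteq> {} \<and>
    (\<forall>x\<in>J c. \<forall>y\<in>J c. x < y \<longrightarrow> g x y = c))" for X J
  have goodD: "J c \<subseteq> X" "J c \<noteq> {}" "\<And>x y. x \<in> J c \<Longrightarrow> y \<in> J c \<Longrightarrow> x < y \<Longrightarrow> g x y = c"
    if "good X J" "c \<in> C" for J X c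
    using that unfolding good_def by auto
  define M where "M = 4 * (K + 1)\<^sup>2"
  \<comment> \<open>The exponent satisfies \<open>M powr \<beta> = 2\<close>: a side with at least
    \<open>card X / M\<close> points keeps at least half of the power, so the bounds of the two
    sides add up to the bound for \<open>X\<close>.\<close>
  define \<beta> where "\<beta> = log (real M) 2"
  have Mr: "4 * (real K + 1)\<^sup>2 = real M" unfolding M_def by (simp add: algebra_simps power2_eq_square)
  have M4: "M \<ge> 4" unfolding M_def by simp
  have b0: "\<beta> > 0" unfolding \<beta>_def log_def using M4 by (intro divide_pos_pos) simp_all
  have Mb: "real M powr \<beta> = 2" unfolding \<beta>_def using M4 by simp
  have "\<exists>J. good X J \<and> real (card X) powr \<beta> \<le> (\<Prod>c\<in>C. real (card (J c)))"
    using X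
  proof (induction "card X" arbitrary: X rule: less_induct)
    case less
    consider "card X = 1" | "card X \<ge> 2" "card X < M" | "card X \<ge> M"
    proof -
      have "card X > 0" using less.prems by (simp add: card_gt_0_iff)
      then show ?thesis using that by linarith
    qed
    then show ?case
    proof cases
      case 1
      then obtain x where "X = {x}" by (auto simp: card_1_singleton_iff)
      then show "\<exists>J. good X J \<and> real (card X) powr \<beta> \<le> (\<Prod>c\<in>C. real (card (J c)))"
        by (intro exI[of _ "\<lambda>_. X"]) (auto simp: good_def)
    next
      case 2
      \<comment> \<open>Below \<open>M\<close> points the bound is at most 2, so a single pair in
        its own colour and singletons in all other colours suffice.\<close>
      obtain x y where xy: "x \<in> X" "y \<in> X" "x < y"
      proof -
        obtain T where "T \<subseteq> X" "card T = 2" using obtain_subset_with_card_n[OF 2(1)] by blast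
        then obtain a b where "a \<in> X" "b \<in> X" "a \<noteq> b" by (auto simp: card_2_iff)
        then show ?thesis using that by (meson linorder_neqE)
      qed
      have "real (card X) powr \<beta> \<le> real M powr \<beta>" using 2 b0 by (intro powr_mono2) auto
      also have "\<dots> = real (card {x, y})" using Mb xy by simp
      also have "\<dots> = (\<Prod>c\<in>C. if c = g x y then real (card {x, y}) else 1)"
        using C by (subst prod.delta) simp_all
      also have "\<dots> = (\<Prod>c\<in>C. real (card (if c = g x y then {x, y} else {x})))"
        by (intro prod.cong refl) simp
      finally show "\<exists>J. good X J \<and> real (card X) powr \<beta> \<le> (\<Prod>c\<in>C. real (card (J c)))"
        using xy by (intro exI[of _ "\<lambda>c. if c = g x y then {x, y} else {x}"] conjI) (auto simp: good_def)
    next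
      case 3
      obtain A B \<kappa> where AB: "A \<subseteq> X" "B \<subseteq> X" "\<kappa> \<in> C" "card X \<le> M * card A" "card X \<le> M * card B"
        "\<And>x y. x \<in> A \<Longrightarrow> y \<in> B \<Longrightarrow> x < y \<and> g x y = \<kappa>"
        using homogeneous_bipartite[where g = g, OF less.prems(1) C g 3[unfolded M_def], folded M_def]
        by blast
      have fin: "finite A" "finite B" using AB less.prems finite_subset by auto
      have ne: "A \<noteq> {}" "B \<noteq> {}" using AB 3 M4 by auto
      have "A \<inter> B = {}" using AB(6) by fastforce
      then have "A \<subset> X" "B \<subset> X" using AB ne by auto
      then have lt: "card A < card X" "card B < card X" using less.prems psubset_card_mono by auto
      obtain JA where JA: "good A JA"
        "real (card A) powr \<beta> \<le> (\<Prod>c\<in>C. real (card (JA c)))"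
        using less.hyps[OF lt(1) fin(1) ne(1)] by blast
      obtain JB where JB: "good B JB"
        "real (card B) powr \<beta> \<le> (\<Prod>c\<in>C. real (card (JB c)))"
        using less.hyps[OF lt(2) fin(2) ne(2)] by blast
      define J where "J c = (if c = \<kappa> then JA c \<union> JB c else if card (JA c) \<ge> card (JB c) then JA c else JB c)" for c
      let ?R = "\<Prod>c\<in>C - {\<kappa>}. real (card (J c))"
      have half: "real (card X) powr \<beta> \<le> 2 * real (card Y) powr \<beta>" if "card X \<le> M * card Y" for Y :: "'a set"
      proof -
        have "real (card X) \<le> real M * real (card Y)" using that by (metis of_nat_le_iff of_nat_mult)
        then have "real (card X) powr \<beta> \<le> (real M * real (card Y)) powr \<beta>" using b0 by (intro powr_mono2) auto
        then show ?thesis using Mb by (simp add: powr_mult)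
      qed
      have le: "(\<Prod>c\<in>C. real (card (J' c))) \<le> real (card (J' \<kappa>)) * ?R"
        if "J' = JA \<or> J' = JB" for J'
      proof -
        have "(\<Prod>c\<in>C. real (card (J' c))) = real (card (J' \<kappa>)) * (\<Prod>c\<in>C - {\<kappa>}. real (card (J' c)))"
          using C AB(3) by (simp add: prod.remove)
        moreover have "(\<Prod>c\<in>C - {\<kappa>}. real (card (J' c))) \<le> ?R"
          using that by (intro prod_mono) (auto simp: J_def)
        ultimately show ?thesis by (simp add: mult_left_mono)
      qed
      have "real (card X) powr \<beta> \<le> real (card A) powr \<beta> + real (card B) powr \<beta>"
        using half[OF AB(4)] half[OF AB(5)] by linarith
      also have "\<dots> \<le> (real (card (JA \<kappa>)) + real (card (JB \<kappa>))) * ?R"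
        using JA(2) JB(2) le[of JA] le[of JB] by (simp add: distrib_right)
      also have "real (card (JA \<kappa>)) + real (card (JB \<kappa>)) = real (card (J \<kappa>))"
      proof -
        have "JA \<kappa> \<inter> JB \<kappa> = {}" using goodD(1)[OF JA(1) AB(3)] goodD(1)[OF JB(1) AB(3)] \<open>A \<inter> B = {}\<close> by blast
        then show ?thesis using goodD(1)[OF JA(1) AB(3)] goodD(1)[OF JB(1) AB(3)] fin
          by (simp add: J_def card_Un_disjoint finite_subset)
      qed
      also have "real (card (J \<kappa>)) * ?R = (\<Prod>c\<in>C. real (card (J c)))"
        using C AB(3) by (simp add: prod.remove)
      finally have bound: "real (card X) powr \<beta> \<le> (\<Prod>c\<in>C. real (card (J c)))" .
      have "good X J" unfolding good_def
      proof (intro ballI conjI impI)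
        fix c assume c: "c \<in> C"
        show "J c \<subseteq> X" using goodD(1)[OF JA(1) c] goodD(1)[OF JB(1) c] AB(1,2) by (auto simp: J_def)
        show "J c \<noteq> {}" using goodD(2)[OF JA(1) c] goodD(2)[OF JB(1) c] by (auto simp: J_def)
        fix x y assume xy: "x \<in> J c" "y \<in> J c" "x < y"
        consider "x \<in> JA c" "y \<in> JA c" | "x \<in> JB c" "y \<in> JB c" | "c = \<kappa>" "x \<in> A" "y \<in> B"
          | "x \<in> B" "y \<in> A"
          using xy goodD(1)[OF JA(1) c] goodD(1)[OF JB(1) c] by (auto simp: J_def split: if_splits)
        then show "g x y = c"
          using goodD(3)[OF JA(1) c] goodD(3)[OF JB(1) c] xy(3) AB(6) by cases (auto dest: order.asym)
      qed
      then show ?thesis using bound by blast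
    qed
  qed
  then show ?thesis unfolding good_def \<beta>_def Mr .
qed

section \<open>Monochromatic sets of polynomial size\<close>

text \<open>The exponent of the product bound is shared among the colours. Dividing by
  \<open>K + 1\<close> keeps it positive at \<open>K = 0\<close>.\<close>

definition ramsey_exponent :: "nat \<Rightarrow> real" where
  "ramsey_exponent K = log (4 * (real K + 1)\<^sup>2) 2 / (real K + 1)"

lemma ramsey_exponent_bounds: "0 < ramsey_exponent K" "ramsey_exponent K \<le> 1"
proof -
  have "4 * (real K + 1)\<^sup>2 \<ge> 4 * 1\<^sup>2" by (intro mult_left_mono power_mono) auto
  then have *: "4 * (real K + 1)\<^sup>2 \<ge> 4" by simp
  then have "4 * (real K + 1)\<^sup>2 > 1" by linarith
  from ln_gt_zero[OF this] have "log (4 * (real K + 1)\<^sup>2) 2 > 0"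
    unfolding log_def by (rule divide_pos_pos[rotated]) simp
  then show "0 < ramsey_exponent K" unfolding ramsey_exponent_def by (rule divide_pos_pos) simp
  have "ln 2 \<le> ln (4 * (real K + 1)\<^sup>2)" using * by (intro ln_mono) linarith+
  moreover have "ln (4 * (real K + 1)\<^sup>2) > 0" using * by (intro ln_gt_zero) linarith
  ultimately have "log (4 * (real K + 1)\<^sup>2) 2 \<le> 1" unfolding log_def by (simp only: divide_le_eq_1_pos)
  then show "ramsey_exponent K \<le> 1" unfolding ramsey_exponent_def by (simp add: divide_le_eq)
qed

text \<open>If all factors in \<open>homogeneous_product\<close> were below
  \<open>card X powr ramsey_exponent K\<close>, their product would be below the
  \<open>(K + 1)\<close>-st power of that number, which is the lower bound proved there.\<close>

lemma monochromatic_subset: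
  fixes X :: "'a::linorder set" and g :: "'a \<Rightarrow> 'a \<Rightarrow> 'c"
  assumes X: "finite X" and C: "finite C" "card C \<le> K" "\<And>x y. g x y \<in> C"
    and g: "\<And>x. convex_coloring (g x)"
  shows "\<exists>J\<subseteq>X. \<exists>c. (\<forall>x\<in>J. \<forall>y\<in>J. x < y \<longrightarrow> g x y = c) \<and>
    real (card X) powr ramsey_exponent K \<le> real (card J)"
proof (cases "X = {}")
  case True
  then show ?thesis by auto
next
  case False
  define \<beta> where "\<beta> = log (4 * (real K + 1)\<^sup>2) 2"
  obtain J where J: "\<forall>c\<in>C. J c \<subseteq> X \<and> J c \<noteq> {} \<and> (\<forall>x\<in>J c. \<forall>y\<in>J c. x < y \<longrightarrow> g x y = c)"
    "real (card X) powr \<beta> \<le> (\<Prod>c\<in>C. real (card (J c)))"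
    using homogeneous_product[where g = g, OF X False C g] unfolding \<beta>_def[symmetric]
    by (elim exE conjE) (rule that, assumption+)
  define x where "x = real (card X) powr ramsey_exponent K"
  have x1: "x \<ge> 1" unfolding x_def using X False ramsey_exponent_bounds[of K]
    by (intro ge_one_powr_ge_zero) (auto simp: Suc_le_eq card_gt_0_iff)
  have "\<exists>c\<in>C. x \<le> real (card (J c))"
  proof (rule ccontr)
    assume "\<not> ?thesis"
    then have lt: "\<And>c. c \<in> C \<Longrightarrow> real (card (J c)) < x" by force
    obtain c0 where "c0 \<in> C" using C(3) by blast
    then have "(\<Prod>c\<in>C. real (card (J c))) < (\<Prod>c\<in>C. x)"
      using lt x1 C(1) by (intro prod_mono_strict[of c0]) (auto intro: less_imp_le)
    also have "\<dots> = x ^ card C" by simp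
    also have "\<dots> \<le> x ^ (K + 1)" using C x1 by (intro power_increasing) auto
    also have "\<dots> = x powr real (K + 1)" using x1 by (intro powr_realpow[symmetric]) simp
    also have "\<dots> = real (card X) powr (ramsey_exponent K * real (K + 1))"
      unfolding x_def by (rule powr_powr)
    also have "ramsey_exponent K * real (K + 1) = \<beta>"
    proof -
      have "real (K + 1) = real K + 1" "real K + 1 \<noteq> 0" by simp_all
      then show ?thesis unfolding ramsey_exponent_def \<beta>_def by (simp only: nonzero_mult_div_cancel_right times_divide_eq_left not_False_eq_True)
    qed
    finally show False using J(2) by simp
  qed
  then show ?thesis using J(1) unfolding x_def by blast
qed

text \<open>Each colouring in \<open>T\<close> is treated inside the set found for the previous
  ones. Every round multiplies the exponent by \<open>ramsey_exponent K\<close>, so the size stays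
  polynomial.\<close>

lemma simultaneous_monochromatic_subset:
  fixes X :: "'a::linorder set" and g :: "'i \<Rightarrow> 'a \<Rightarrow> 'a \<Rightarrow> 'c"
  assumes "finite T" and X: "finite X" and C: "finite C" "card C \<le> K" "\<And>i x y. g i x y \<in> C"
    and g: "\<And>i x. convex_coloring (g i x)"
  shows "\<exists>J\<subseteq>X. (\<forall>i\<in>T. \<exists>c. \<forall>x\<in>J. \<forall>y\<in>J. x < y \<longrightarrow> g i x y = c) \<and>
    real (card X) powr (ramsey_exponent K ^ card T) \<le> real (card J)"
  using assms(1)
proof (induction T)
  case empty
  show ?case by (intro exI[of _ X]) (use X in auto)
next
  case (insert i T)
  then obtain J where J: "J \<subseteq> X" "\<forall>i\<in>T. \<exists>c. \<forall>x\<in>J. \<forall>y\<in>J. x < y \<longrightarrow> g i x y = c"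
    "real (card X) powr (ramsey_exponent K ^ card T) \<le> real (card J)" by blast
  have "finite J" using J X finite_subset by blast
  from monochromatic_subset[where g = "g i", OF this C g] obtain J' where
    J': "J' \<subseteq> J" "\<exists>c. \<forall>x\<in>J'. \<forall>y\<in>J'. x < y \<longrightarrow> g i x y = c"
    "real (card J) powr ramsey_exponent K \<le> real (card J')" by blast
  have "real (card X) powr (ramsey_exponent K ^ card (insert i T))
      = (real (card X) powr (ramsey_exponent K ^ card T)) powr ramsey_exponent K"
    using insert by (simp add: powr_powr mult.commute)
  also have "\<dots> \<le> real (card J) powr ramsey_exponent K"
    using J(3) ramsey_exponent_bounds[of K] by (intro powr_mono2) auto
  finally have "real (card X) powr (ramsey_exponent K ^ card (insert i T)) \<le> real (card J')"
    using J' by linarith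
  moreover have "\<forall>i\<in>insert i T. \<exists>c. \<forall>x\<in>J'. \<forall>y\<in>J'. x < y \<longrightarrow> g i x y = c"
  proof
    fix k assume "k \<in> insert i T"
    then show "\<exists>c. \<forall>x\<in>J'. \<forall>y\<in>J'. x < y \<longrightarrow> g k x y = c" using J(2) J'(1,2) by (cases "k = i") (simp, blast)
  qed
  moreover have "J' \<subseteq> X" using J(1) J'(1) by (rule order.trans[rotated])
  ultimately show ?case by (intro exI[of _ J'] conjI)
qed

subsection \<open>Free sets\<close>

text \<open>Union bound over all maps from an \<open>m\<close>-element set to \<open>V\<close>.\<close>
lemma free_set_exists:
  fixes F :: "'a \<Rightarrow> 'a \<Rightarrow> 'a set"
  assumes V: "finite V" and F: "\<And>a b. finite (F a b)" "\<And>a b. card (F a b) \<le> D"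
    and large: "m ^ 3 * D + m\<^sup>2 < card V"
  shows "\<exists>S\<subseteq>V. card S = m \<and> (\<forall>a\<in>S. \<forall>b\<in>S. \<forall>c\<in>S. c \<noteq> a \<longrightarrow> c \<noteq> b \<longrightarrow> c \<notin> F a b)"
proof (cases "m = 0")
  case True
  then show ?thesis by (intro exI[of _ "{}"]) auto
next
  case False
  define L where "L = {..<m} \<rightarrow>\<^sub>E V"
  \<comment> \<open>The forbidden set \<open>G\<close> sees only the values of \<open>h\<close> away
    from \<open>c\<close>. Hence each choice of the other values leaves at most \<open>d\<close> bad
    values at \<open>c\<close>.\<close>
  define Bad where "Bad c G = {h\<in>L. h c \<in> G (restrict h ({..<m} - {c}))}" for c and G :: "(nat \<Rightarrow> 'a) \<Rightarrow> 'a set"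
  have finL: "finite L" unfolding L_def using V by (intro finite_PiE) auto
  have cardL: "card L = card V ^ m" unfolding L_def by (simp add: card_PiE)
  have bad: "card (Bad c G) \<le> card V ^ (m - 1) * d"
    if c: "c < m" and G: "\<And>h. finite (G h)" "\<And>h. card (G h) \<le> d" for c d G
  proof -
    let ?L' = "({..<m} - {c}) \<rightarrow>\<^sub>E V"
    have fin': "finite ?L'" using V by (intro finite_PiE) auto
    have inj: "inj_on (\<lambda>h. (restrict h ({..<m} - {c}), h c)) (Bad c G)"
    proof (rule inj_onI)
      fix h k assume hk: "h \<in> Bad c G" "k \<in> Bad c G"
        and eq: "(restrict h ({..<m} - {c}), h c) = (restrict k ({..<m} - {c}), k c)"
      show "h = k"
      proof
        fix x
        show "h x = k x"
        proof (cases "x < m")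
          case True
          have "restrict h ({..<m} - {c}) x = restrict k ({..<m} - {c}) x" "h c = k c" using eq by simp_all
          then show ?thesis using True by (cases "x = c") auto
        next
          case False
          have "h \<in> L" "k \<in> L" using hk unfolding Bad_def by simp_all
          then show ?thesis using False unfolding L_def by (simp add: PiE_def extensional_def)
        qed
      qed
    qed
    have "(\<lambda>h. (restrict h ({..<m} - {c}), h c)) ` Bad c G \<subseteq> Sigma ?L' G"
    proof (rule image_subsetI)
      fix h assume "h \<in> Bad c G"
      then have "h \<in> L" "h c \<in> G (restrict h ({..<m} - {c}))" unfolding Bad_def by simp_all
      moreover have "restrict h ({..<m} - {c}) \<in> ?L'"
        using \<open>h \<in> L\<close> unfolding L_def by (intro restrict_PiE_iff[THEN iffD2]) (auto dest: PiE_mem)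
      ultimately show "(restrict h ({..<m} - {c}), h c) \<in> Sigma ?L' G" by simp
    qed
    moreover have "finite (Sigma ?L' G)" using fin' G by auto
    ultimately have "card (Bad c G) \<le> card (Sigma ?L' G)" by (rule card_inj_on_le[OF inj])
    also have "\<dots> = (\<Sum>h\<in>?L'. card (G h))" using fin' G by simp
    also have "\<dots> \<le> (\<Sum>h\<in>?L'. d)" by (intro sum_mono G)
    also have "\<dots> = card V ^ (m - 1) * d" using c by (simp add: card_PiE)
    finally show ?thesis .
  qed
  \<comment> \<open>Coinciding indices are included for simplicity: there the restriction returns
    its default value, and the count is the same because the bounds on \<open>F\<close> hold for all
    arguments. The pairs in \<open>P\<close> make the surviving map injective.\<close>
  define T where "T = ({..<m} \<times> {..<m} \<times> {..<m})"
  define P where "P = ({..<m} \<times> {..<m})"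
  define U where "U = (\<Union>(a, b, c)\<in>T. Bad c (\<lambda>h. F (h a) (h b))) \<union> (\<Union>(a, c)\<in>P. Bad c (\<lambda>h. {h a}))"
  have "card U \<le> card (\<Union>(a, b, c)\<in>T. Bad c (\<lambda>h. F (h a) (h b))) + card (\<Union>(a, c)\<in>P. Bad c (\<lambda>h. {h a}))"
    unfolding U_def by (rule card_Un_le)
  also have "\<dots> \<le> (\<Sum>(a, b, c)\<in>T. card (Bad c (\<lambda>h. F (h a) (h b)))) + (\<Sum>(a, c)\<in>P. card (Bad c (\<lambda>h. {h a})))"
    unfolding case_prod_unfold by (intro add_mono card_UN_le) (auto simp: T_def P_def)
  also have "\<dots> \<le> (\<Sum>(a, b, c)\<in>T. card V ^ (m - 1) * D) + (\<Sum>(a, c)\<in>P. card V ^ (m - 1) * 1)"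
    unfolding case_prod_unfold by (intro add_mono sum_mono bad) (auto simp: T_def P_def F)
  also have "\<dots> = card V ^ (m - 1) * (m ^ 3 * D + m\<^sup>2)"
    by (simp add: case_prod_unfold T_def P_def algebra_simps power2_eq_square power3_eq_cube)
  also have "\<dots> < card V ^ (m - 1) * card V" using large by (intro mult_strict_left_mono) auto
  also have "\<dots> = card L" using False by (simp add: cardL power_eq_if)
  finally have "card U < card L" .
  then have "\<not> L \<subseteq> U"
  proof -
    have "finite U" unfolding U_def T_def P_def by (auto intro: finite_subset[OF _ finL] simp: Bad_def)
    then show ?thesis using \<open>card U < card L\<close> card_mono[of U L] by auto
  qed
  then obtain h where h: "h \<in> L" "h \<notin> U" by blast
  have 1: "h c \<notin> F (h a) (h b)" if "a < m" "b < m" "c < m" "c \<noteq> a" "c \<noteq> b" for a b c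
  proof -
    have "h \<notin> Bad c (\<lambda>h. F (h a) (h b))" using h(2) that unfolding U_def T_def by auto
    then show ?thesis using h(1) that unfolding Bad_def by auto
  qed
  have 2: "h c \<noteq> h a" if "a < m" "c < m" "c \<noteq> a" for a c
  proof -
    have "h \<notin> Bad c (\<lambda>h. {h a})" using h(2) that unfolding U_def P_def by auto
    then show ?thesis using h(1) that unfolding Bad_def by auto
  qed
  have "inj_on h {..<m}" using 2 by (auto intro!: inj_onI)
  then have "card (h ` {..<m}) = m" by (simp add: card_image)
  moreover have "h ` {..<m} \<subseteq> V" using h(1) unfolding L_def by auto
  ultimately show ?thesis using 1 by (intro exI[of _ "h ` {..<m}"]) auto
qed

subsection \<open>Convex colourings of triples\<close>

definition convex_coloring3 :: "('a::linorder \<Rightarrow> 'a \<Rightarrow> 'a \<Rightarrow> 'c) \<Rightarrow> bool" where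
  "convex_coloring3 \<chi> \<longleftrightarrow> (\<forall>y z. convex_coloring (\<lambda>x. \<chi> x y z)) \<and>
     (\<forall>x z. convex_coloring (\<lambda>y. \<chi> x y z)) \<and> (\<forall>x y. convex_coloring (\<chi> x y))"

lemma convex_coloring3D:
  assumes "convex_coloring3 \<chi>"
  shows "convex_coloring (\<lambda>x. \<chi> x y z)" "convex_coloring (\<lambda>y. \<chi> x y z)" "convex_coloring (\<chi> x y)"
  using assms unfolding convex_coloring3_def by auto

text \<open>The power counts the pair colourings made constant at once: two sides, each with the
  \<open>2 * K + 2\<close> endpoints of \<open>2 * K + 1\<close> shells.\<close>

definition block_exponent :: "nat \<Rightarrow> real" where
  "block_exponent K = ramsey_exponent K ^ (2 * (2 * K + 2))"

lemma block_exponent_bounds: "0 < block_exponent K" "block_exponent K \<le> 1"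
  unfolding block_exponent_def using ramsey_exponent_bounds[of K]
  by (intro zero_less_power power_le_one; simp)+

section \<open>Shells seen in one colour\<close>

text \<open>Consecutive endpoints form two-point blocks for \<open>card_nonconstant_blocks\<close>.
  Both directions occur: right ends of growing intervals increase and left ends decrease.\<close>

lemma card_color_changes:
  fixes R :: "nat \<Rightarrow> 'a::linorder"
  assumes g: "convex_coloring g" and C: "finite C" "range g \<subseteq> C"
    and R: "mono R \<or> antimono R"
  shows "card {a\<in>{..<q}. g (R a) \<noteq> g (R (Suc a))} \<le> card C"
proof -
  have "{a\<in>{..<q}. g (R a) \<noteq> g (R (Suc a))}
      = {a\<in>{..<q}. \<exists>x\<in>{R a, R (Suc a)}. \<exists>y\<in>{R a, R (Suc a)}. g x \<noteq> g y}" by auto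
  also have "card \<dots> \<le> card C"
  proof (rule card_nonconstant_blocks[OF g C])
    fix i j :: nat assume "i \<noteq> j"
    have *: "(\<forall>x\<in>{R i, R (Suc i)}. \<forall>y\<in>{R j, R (Suc j)}. x \<le> y) \<or>
      (\<forall>x\<in>{R i, R (Suc i)}. \<forall>y\<in>{R j, R (Suc j)}. y \<le> x)" if "i < j" for i j
      using R
    proof
      assume "mono R"
      from monoD[OF this] show ?thesis using that by (intro disjI1) (auto simp: Suc_leI)
    next
      assume "antimono R"
      from antimonoD[OF this] show ?thesis using that by (intro disjI2) (auto simp: Suc_leI)
    qed
    show "(\<forall>x\<in>{R i, R (Suc i)}. \<forall>y\<in>{R j, R (Suc j)}. x \<le> y) \<or>
      (\<forall>x\<in>{R i, R (Suc i)}. \<forall>y\<in>{R j, R (Suc j)}. y \<le> x)"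
      using *[of i j] *[of j i] \<open>i \<noteq> j\<close> by (cases i j rule: linorder_cases) blast+
  qed
  finally show ?thesis .
qed

text \<open>The pair colourings given by all endpoints \<open>R a\<close> and \<open>L a\<close> are
  made constant on \<open>J\<close> together, so one pair of \<open>J\<close> decides for all. For
  that pair at most \<open>K\<close> steps on either side change the colour, which leaves one of the
  \<open>2 * K + 1\<close> shells unchanged on both sides. Convexity then fills in the points
  between its endpoints.\<close>

lemma uncut_shell:
  fixes \<chi> :: "'a::linorder \<Rightarrow> 'a \<Rightarrow> 'a \<Rightarrow> 'c" and R L :: "nat \<Rightarrow> 'a"
  assumes \<chi>: "convex_coloring3 \<chi>" and C: "finite C" "card C \<le> K" "\<And>x y z. \<chi> x y z \<in> C"
    and X: "finite X" and R: "mono R" and L: "antimono L"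
  shows "\<exists>J\<subseteq>X. \<exists>a<2 * K + 1. \<exists>\<rho> \<sigma>. real (card X) powr block_exponent K \<le> real (card J) \<and>
    (\<forall>x\<in>J. \<forall>x'\<in>J. x < x' \<longrightarrow> (\<forall>y\<in>{R a..R (Suc a)}. \<chi> x x' y = \<rho>) \<and>
      (\<forall>y\<in>{L (Suc a)..L a}. \<chi> y x x' = \<sigma>))"
proof -
  define T where "T = (UNIV :: bool set) \<times> {..2 * K + 1}"
  define g where "g = (\<lambda>(b, a) x x'. if b then \<chi> x x' (R a) else \<chi> (L a) x x')"
  have cT: "card T = 2 * (2 * K + 2)" unfolding T_def by (simp add: card_cartesian_product)
  have "finite T" unfolding T_def by simp
  moreover have "g i x y \<in> C" for i x y unfolding g_def using C by (auto split: prod.split)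
  moreover have "convex_coloring (g i x)" for i x
    using convex_coloring3D[OF \<chi>] by (cases i, cases "fst i") (auto simp: g_def)
  ultimately obtain J where J: "J \<subseteq> X" "\<forall>i\<in>T. \<exists>c. \<forall>x\<in>J. \<forall>y\<in>J. x < y \<longrightarrow> g i x y = c"
    "real (card X) powr block_exponent K \<le> real (card J)"
    using simultaneous_monochromatic_subset[where g = g and T = T and X = X and C = C and K = K] X C(1,2)
    unfolding cT block_exponent_def by blast
  show ?thesis
  proof (cases "\<exists>u\<in>J. \<exists>v\<in>J. u < v")
    case False
    \<comment> \<open>Without a pair in \<open>J\<close> the colour conditions are vacuous, so any
      shell and any colours will do.\<close>
    then show ?thesis using J(1,3)
      by (intro exI[of _ J] conjI exI[of _ 0] exI[of _ undefined]) simp_all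
  next
    case True
    then obtain u v where uv: "u \<in> J" "v \<in> J" "u < v" by blast
    let ?SR = "{a\<in>{..<2 * K + 1}. \<chi> u v (R a) \<noteq> \<chi> u v (R (Suc a))}"
    let ?SL = "{a\<in>{..<2 * K + 1}. \<chi> (L a) u v \<noteq> \<chi> (L (Suc a)) u v}"
    have "card ?SR \<le> card C"
      using convex_coloring3D(3)[OF \<chi>] C R by (intro card_color_changes) auto
    moreover have "card ?SL \<le> card C"
      using card_color_changes[OF convex_coloring3D(1)[OF \<chi>] C(1), of u v L] C L by auto
    ultimately have "card (?SR \<union> ?SL) \<le> 2 * K" using C(2) card_Un_le[of ?SR ?SL] by linarith
    moreover have "card (?SR \<union> ?SL) = 2 * K + 1" if "?SR \<union> ?SL = {..<2 * K + 1}" using that by simp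
    ultimately have "?SR \<union> ?SL \<noteq> {..<2 * K + 1}" by linarith
    then obtain a where a: "a < 2 * K + 1" "\<chi> u v (R a) = \<chi> u v (R (Suc a))"
      "\<chi> (L a) u v = \<chi> (L (Suc a)) u v" by blast
    have homR: "\<chi> x x' (R b) = \<chi> u v (R b)" if "b \<le> 2 * K + 1" "x \<in> J" "x' \<in> J" "x < x'" for b x x'
    proof -
      have "(True, b) \<in> T" using that unfolding T_def by simp
      then obtain c where "\<forall>x\<in>J. \<forall>y\<in>J. x < y \<longrightarrow> g (True, b) x y = c" using J(2) by blast
      then show ?thesis using that uv by (simp add: g_def)
    qed
    have homL: "\<chi> (L b) x x' = \<chi> (L b) u v" if "b \<le> 2 * K + 1" "x \<in> J" "x' \<in> J" "x < x'" for b x x'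
    proof -
      have "(False, b) \<in> T" using that unfolding T_def by simp
      then obtain c where "\<forall>x\<in>J. \<forall>y\<in>J. x < y \<longrightarrow> g (False, b) x y = c" using J(2) by blast
      then show ?thesis using that uv by (simp add: g_def)
    qed
    have "\<chi> x x' y = \<chi> u v (R a)" if "x \<in> J" "x' \<in> J" "x < x'" "y \<in> {R a..R (Suc a)}" for x x' y
      using convex_coloringD[OF convex_coloring3D(3)[OF \<chi>], of "R a" y "R (Suc a)" x x'] that
        homR[of a x x'] homR[of "Suc a" x x'] a by simp
    moreover have "\<chi> y x x' = \<chi> (L (Suc a)) u v" if "x \<in> J" "x' \<in> J" "x < x'" "y \<in> {L (Suc a)..L a}" for x x' y
      using convex_coloringD[OF convex_coloring3D(1)[OF \<chi>], of "L (Suc a)" y "L a" x x'] that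
        homL[of a x x'] homL[of "Suc a" x x'] a by simp
    ultimately show ?thesis using J(1,3) a(1)
      by (intro exI[of _ J] conjI exI[of _ a] exI[of _ "\<chi> u v (R a)"] exI[of _ "\<chi> (L (Suc a)) u v"] ballI impI) simp_all
  qed
qed

text \<open>
  In the \<open>w\<close>-ary tree of depth \<open>q\<close> the node \<open>j\<close> at height \<open>a\<close> has the leaves \<open>i\<close> with \<open>i div w ^ a = j\<close>.
  Otherwise one could descend from the root, always into a child without leaves of the level just passed.
\<close>
lemma full_tree_node:
  fixes lev :: "nat \<Rightarrow> nat"
  assumes w: "w > 0" and lev: "\<And>i. i < w ^ q \<Longrightarrow> lev i < q"
  shows "\<exists>a<q. \<exists>j. \<forall>c<w. \<exists>i<w ^ q. i div w ^ a = j * w + c \<and> lev i = a"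
proof (rule ccontr)
  assume "\<not> ?thesis"
  then have no: "\<And>a j. a < q \<Longrightarrow> \<exists>c<w. \<forall>i<w ^ q. i div w ^ a = j * w + c \<longrightarrow> lev i \<noteq> a" by blast
  \<comment> \<open>Invariant of the descent: every leaf below the node \<open>j\<close> at height
    \<open>q - d\<close> belongs to the tree and has level below \<open>q - d\<close>. At depth
    \<open>q\<close> the node is itself a leaf, and its level would be negative.\<close>
  have "\<exists>j. \<forall>i. i div w ^ (q - d) = j \<longrightarrow> i < w ^ q \<and> \<not> (q - d \<le> lev i)" if "d \<le> q" for d
    using that
  proof (induction d)
    case 0
    show ?case
      by (rule exI[of _ 0]) (use w lev in \<open>auto simp: div_eq_0_iff not_le\<close>)
  next
    case (Suc d)
    define a where "a = q - Suc d"
    have a: "q - d = Suc a" "a < q" using Suc.prems unfolding a_def by auto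
    obtain j where j: "\<And>i. i div w ^ Suc a = j \<Longrightarrow> i < w ^ q \<and> \<not> (Suc a \<le> lev i)"
      using Suc a by auto
    obtain c where c: "c < w" "\<And>i. i < w ^ q \<Longrightarrow> i div w ^ a = j * w + c \<Longrightarrow> lev i \<noteq> a"
      using no[OF a(2)] by blast
    have "i < w ^ q \<and> \<not> a \<le> lev i" if "i div w ^ a = j * w + c" for i
    proof -
      have "i div w ^ Suc a = (i div w ^ a) div w" by (simp only: power_Suc2 div_mult2_eq)
      also have "\<dots> = j" using that c(1) by simp
      finally show ?thesis using j[of i] c(2)[of i] that by auto
    qed
    then show ?case unfolding a_def[symmetric] by blast
  qed
  from this[of q] obtain j where "j div w ^ 0 = j \<longrightarrow> j < w ^ q \<and> \<not> 0 \<le> lev j" by auto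
  then show False by simp
qed

section \<open>Blocks with controlled colours across them\<close>

text \<open>Triples inside a single block are left unconstrained; they are handled by recursion into
  the blocks.\<close>

definition homogeneous_blocks ::
  "('a::linorder \<Rightarrow> 'a \<Rightarrow> 'a \<Rightarrow> 'c) \<Rightarrow> nat set \<Rightarrow> (nat \<Rightarrow> 'a set) \<Rightarrow> (nat \<Rightarrow> 'c) \<Rightarrow> (nat \<Rightarrow> 'c) \<Rightarrow> bool" where
  "homogeneous_blocks \<chi> S J \<rho> \<sigma> \<longleftrightarrow>
    (\<forall>i\<in>S. \<forall>j\<in>S. i < j \<longrightarrow> (\<forall>x\<in>J i. \<forall>y\<in>J j. x < y)) \<and>
    (\<forall>i\<in>S. \<forall>j\<in>S. i < j \<longrightarrow> (\<forall>x\<in>J i. \<forall>x'\<in>J i. \<forall>y\<in>J j. x < x' \<longrightarrow> \<chi> x x' y = \<rho> i)) \<and>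
    (\<forall>i\<in>S. \<forall>j\<in>S. i < j \<longrightarrow> (\<forall>x\<in>J i. \<forall>y\<in>J j. \<forall>y'\<in>J j. y < y' \<longrightarrow> \<chi> x y y' = \<sigma> j)) \<and>
    (\<forall>i\<in>S. \<forall>j\<in>S. \<forall>k\<in>S. i < j \<longrightarrow> j < k \<longrightarrow>
      (\<forall>x\<in>J i. \<forall>x'\<in>J i. \<forall>y\<in>J j. \<forall>y'\<in>J j. \<forall>z\<in>J k. \<forall>z'\<in>J k. \<chi> x y z = \<chi> x' y' z'))"

lemma homogeneous_blocksI:
  assumes "\<And>i j x y. i \<in> S \<Longrightarrow> j \<in> S \<Longrightarrow> i < j \<Longrightarrow> x \<in> J i \<Longrightarrow> y \<in> J j \<Longrightarrow> x < y"
    and "\<And>i j x x' y. i \<in> S \<Longrightarrow> j \<in> S \<Longrightarrow> i < j \<Longrightarrow> x \<in> J i \<Longrightarrow> x' \<in> J i \<Longrightarrow> y \<in> J j \<Longrightarrow>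
      x < x' \<Longrightarrow> \<chi> x x' y = \<rho> i"
    and "\<And>i j x y y'. i \<in> S \<Longrightarrow> j \<in> S \<Longrightarrow> i < j \<Longrightarrow> x \<in> J i \<Longrightarrow> y \<in> J j \<Longrightarrow> y' \<in> J j \<Longrightarrow>
      y < y' \<Longrightarrow> \<chi> x y y' = \<sigma> j"
    and "\<And>i j k x x' y y' z z'. i \<in> S \<Longrightarrow> j \<in> S \<Longrightarrow> k \<in> S \<Longrightarrow> i < j \<Longrightarrow> j < k \<Longrightarrow> x \<in> J i \<Longrightarrow> x' \<in> J i \<Longrightarrow>
      y \<in> J j \<Longrightarrow> y' \<in> J j \<Longrightarrow> z \<in> J k \<Longrightarrow> z' \<in> J k \<Longrightarrow> \<chi> x y z = \<chi> x' y' z'"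
  shows "homogeneous_blocks \<chi> S J \<rho> \<sigma>"
  unfolding homogeneous_blocks_def 
  apply (intro conjI ballI impI)
     apply (rule assms(1); assumption)
    apply (rule assms(2); assumption)
   apply (rule assms(3); assumption)
  apply (rule assms(4); assumption)
  done

lemma homogeneous_blocksD:
  assumes "homogeneous_blocks \<chi> S J \<rho> \<sigma>" "i \<in> S" "j \<in> S" "i < j"
  shows "x \<in> J i \<Longrightarrow> y \<in> J j \<Longrightarrow> x < y"
    "x \<in> J i \<Longrightarrow> x' \<in> J i \<Longrightarrow> y \<in> J j \<Longrightarrow> x < x' \<Longrightarrow> \<chi> x x' y = \<rho> i"
    "x \<in> J i \<Longrightarrow> y \<in> J j \<Longrightarrow> y' \<in> J j \<Longrightarrow> y < y' \<Longrightarrow> \<chi> x y y' = \<sigma> j"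
    "k \<in> S \<Longrightarrow> j < k \<Longrightarrow> x \<in> J i \<Longrightarrow> x' \<in> J i \<Longrightarrow> y \<in> J j \<Longrightarrow> y' \<in> J j \<Longrightarrow> z \<in> J k \<Longrightarrow> z' \<in> J k \<Longrightarrow>
      \<chi> x y z = \<chi> x' y' z'"
proof -
  note h = assms(1)[unfolded homogeneous_blocks_def]
  note ij = assms(2-4)
  show "x \<in> J i \<Longrightarrow> y \<in> J j \<Longrightarrow> x < y"
    by (rule h[THEN conjunct1, rule_format, OF ij])
  show "x \<in> J i \<Longrightarrow> x' \<in> J i \<Longrightarrow> y \<in> J j \<Longrightarrow> x < x' \<Longrightarrow> \<chi> x x' y = \<rho> i"
    by (rule h[THEN conjunct2, THEN conjunct1, rule_format, OF ij])
  show "x \<in> J i \<Longrightarrow> y \<in> J j \<Longrightarrow> y' \<in> J j \<Longrightarrow> y < y' \<Longrightarrow> \<chi> x y y' = \<sigma> j"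
    by (rule h[THEN conjunct2, THEN conjunct2, THEN conjunct1, rule_format, OF ij])
  show "k \<in> S \<Longrightarrow> j < k \<Longrightarrow> x \<in> J i \<Longrightarrow> x' \<in> J i \<Longrightarrow> y \<in> J j \<Longrightarrow> y' \<in> J j \<Longrightarrow> z \<in> J k \<Longrightarrow> z' \<in> J k \<Longrightarrow>
      \<chi> x y z = \<chi> x' y' z'"
    by (rule h[THEN conjunct2, THEN conjunct2, THEN conjunct2, rule_format, OF assms(2,3) _ assms(4)])
qed

text \<open>Fix two points in two blocks. Letting a further point run through any of the three
  positions gives convex colourings, each nonconstant on at most \<open>K\<close> blocks. So two
  blocks forbid at most \<open>n * n * (3 * K)\<close> others, and among blocks chosen by
  \<open>free_set_exists\<close> each point of a transversal triple can be moved within its block,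
  one at a time, without changing the colour.\<close>

lemma homogeneous_blocks_of_uncut_blocks:
  fixes \<chi> :: "'a::linorder \<Rightarrow> 'a \<Rightarrow> 'a \<Rightarrow> 'c"
  assumes \<chi>: "convex_coloring3 \<chi>" and C: "finite C" "card C \<le> K" "\<And>x y z. \<chi> x y z \<in> C"
    and J: "\<And>i. i \<in> V \<Longrightarrow> finite (J i)" "\<And>i. i \<in> V \<Longrightarrow> card (J i) \<le> n"
    and V: "finite V" and large: "n ^ 3 * (n * n * (3 * K)) + n\<^sup>2 < card V"
    and ord: "\<And>i j x y. i \<in> V \<Longrightarrow> j \<in> V \<Longrightarrow> i < j \<Longrightarrow> x \<in> J i \<Longrightarrow> y \<in> J j \<Longrightarrow> x < y"
    and right: "\<And>i j x x' y. i \<in> V \<Longrightarrow> j \<in> V \<Longrightarrow> i < j \<Longrightarrow> x \<in> J i \<Longrightarrow> x' \<in> J i \<Longrightarrow> y \<in> J j \<Longrightarrow>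
      x < x' \<Longrightarrow> \<chi> x x' y = \<rho> i"
    and left: "\<And>i j x y y'. i \<in> V \<Longrightarrow> j \<in> V \<Longrightarrow> i < j \<Longrightarrow> x \<in> J i \<Longrightarrow> y \<in> J j \<Longrightarrow> y' \<in> J j \<Longrightarrow>
      y < y' \<Longrightarrow> \<chi> x y y' = \<sigma> j"
  shows "\<exists>S\<subseteq>V. card S = n \<and> homogeneous_blocks \<chi> S J \<rho> \<sigma>"
proof -
  define cut where "cut g = {e\<in>V. \<exists>z\<in>J e. \<exists>z'\<in>J e. g z \<noteq> g z'}" for g :: "'a \<Rightarrow> 'c"
  have cut: "finite (cut g)" "card (cut g) \<le> K" if "convex_coloring g" "range g \<subseteq> C" for g
  proof -
    have *: "(\<forall>x\<in>J i. \<forall>y\<in>J j. x \<le> y) \<or> (\<forall>x\<in>J i. \<forall>y\<in>J j. y \<le> x)"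
      if "i \<in> V" "j \<in> V" "i \<noteq> j" for i j
      using ord[of i j] ord[of j i] that by (cases i j rule: linorder_cases) (auto intro: less_imp_le)
    show "finite (cut g)" unfolding cut_def using V by simp
    show "card (cut g) \<le> K" unfolding cut_def
      using card_nonconstant_blocks[where I = V and B = J, OF that(1) C(1) that(2) *] C(2) by simp
  qed
  define H where "H x y = cut (\<lambda>z. \<chi> z x y) \<union> cut (\<lambda>z. \<chi> x z y) \<union> cut (\<lambda>z. \<chi> x y z)" for x y
  have H: "finite (H x y)" "card (H x y) \<le> 3 * K" for x y
  proof -
    note cs = convex_coloring3D[OF \<chi>]
    have r: "range (\<lambda>z. \<chi> z x y) \<subseteq> C" "range (\<lambda>z. \<chi> x z y) \<subseteq> C" "range (\<lambda>z. \<chi> x y z) \<subseteq> C" using C(3) by auto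
    show "finite (H x y)" unfolding H_def using cut(1)[OF cs(1) r(1)] cut(1)[OF cs(2) r(2)] cut(1)[OF cs(3) r(3)] by simp
    have "card (H x y) \<le> card (cut (\<lambda>z. \<chi> z x y)) + card (cut (\<lambda>z. \<chi> x z y)) + card (cut (\<lambda>z. \<chi> x y z))"
      unfolding H_def by (intro order.trans[OF card_Un_le] add_mono card_Un_le order.refl)
    then show "card (H x y) \<le> 3 * K"
      using cut(2)[OF cs(1) r(1)] cut(2)[OF cs(2) r(2)] cut(2)[OF cs(3) r(3)] by linarith
  qed
  \<comment> \<open>\<open>free_set_exists\<close> asks for its bounds at all indices, hence the
    empty set outside \<open>V\<close>.\<close>
  define F where "F c d = (if c \<in> V \<and> d \<in> V then (\<Union>p\<in>J c \<times> J d. H (fst p) (snd p)) else {})" for c d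
  have "finite (F c d)" "card (F c d) \<le> n * n * (3 * K)" for c d
  proof -
    show "finite (F c d)" unfolding F_def using J H by auto
    show "card (F c d) \<le> n * n * (3 * K)"
    proof (cases "c \<in> V \<and> d \<in> V")
      case True
      then have "card (F c d) \<le> (\<Sum>p\<in>J c \<times> J d. card (H (fst p) (snd p)))"
        unfolding F_def using J by (auto intro: card_UN_le)
      also have "\<dots> \<le> (\<Sum>p\<in>J c \<times> J d. 3 * K)" by (intro sum_mono H)
      also have "\<dots> \<le> n * n * (3 * K)" using J True
        by (simp only: sum_constant of_nat_id card_cartesian_product) (intro mult_mono, auto)
      finally show ?thesis .
    qed (auto simp: F_def)
  qed
  from free_set_exists[where F = F, OF V this large] obtain S where S: "S \<subseteq> V" "card S = n"
    "\<forall>a\<in>S. \<forall>b\<in>S. \<forall>c\<in>S. c \<noteq> a \<longrightarrow> c \<noteq> b \<longrightarrow> c \<notin> F a b"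
    by (elim exE conjE) (rule that)
  have free: "\<chi> z x y = \<chi> z' x y" "\<chi> x z y = \<chi> x z' y" "\<chi> x y z = \<chi> x y z'"
    if "a \<in> S" "b \<in> S" "c \<in> S" "c \<noteq> a" "c \<noteq> b" "x \<in> J a" "y \<in> J b" "z \<in> J c" "z' \<in> J c" for a b c x y z z'
  proof -
    have abc: "a \<in> V" "b \<in> V" "c \<in> V" using that S(1) by auto
    have "H x y \<subseteq> F a b"
      using UN_upper[of "(x, y)" "J a \<times> J b" "\<lambda>p. H (fst p) (snd p)"] that(6,7) abc by (simp add: F_def)
    then have "c \<notin> H x y" using S(3)[rule_format, OF that(1-5)] by blast
    then show "\<chi> z x y = \<chi> z' x y" "\<chi> x z y = \<chi> x z' y" "\<chi> x y z = \<chi> x y z'"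
      using that(8,9) abc(3) unfolding H_def cut_def by blast+
  qed
  have triple: "\<chi> x y z = \<chi> x' y' z'"
    if "i \<in> S" "j \<in> S" "k \<in> S" "i < j" "j < k" "x \<in> J i" "x' \<in> J i" "y \<in> J j" "y' \<in> J j" "z \<in> J k" "z' \<in> J k"
    for i j k x x' y y' z z'
  proof -
    have "\<chi> x y z = \<chi> x y z'" by (rule free(3)[of i j k]) (use that in auto)
    also have "\<dots> = \<chi> x y' z'" by (rule free(2)[of i k j]) (use that in auto)
    also have "\<dots> = \<chi> x' y' z'" by (rule free(1)[of j k i]) (use that in auto)
    finally show ?thesis .
  qed
  have "homogeneous_blocks \<chi> S J \<rho> \<sigma>"
  proof (rule homogeneous_blocksI)
    note SV = subsetD[OF S(1)]
    show "x < y" if "i \<in> S" "j \<in> S" "i < j" "x \<in> J i" "y \<in> J j" for i j x y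
      by (rule ord[OF SV[OF that(1)] SV[OF that(2)] that(3-5)])
    show "\<chi> x x' y = \<rho> i"
      if "i \<in> S" "j \<in> S" "i < j" "x \<in> J i" "x' \<in> J i" "y \<in> J j" "x < x'" for i j x x' y
      by (rule right[OF SV[OF that(1)] SV[OF that(2)] that(3-7)])
    show "\<chi> x y y' = \<sigma> j"
      if "i \<in> S" "j \<in> S" "i < j" "x \<in> J i" "y \<in> J j" "y' \<in> J j" "y < y'" for i j x y y'
      by (rule left[OF SV[OF that(1)] SV[OF that(2)] that(3-7)])
  qed (rule triple)
  then show ?thesis using S(1,2) by (intro exI[of _ S] conjI)
qed

text \<open>The points are divided into \<open>w ^ q\<close> leaf blocks of length \<open>n\<close>
  of a \<open>w\<close>-ary tree, and each leaf block gets an uncut shell between two consecutive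
  ancestors. By \<open>full_tree_node\<close> some node has, below each of its children, a leaf
  block whose uncut shell is the part of the node outside that child. This shell contains the
  siblings, so the sets found below the children see each other in fixed pair colours.\<close>

lemma homogeneous_blocks_nat:
  fixes \<chi> :: "nat \<Rightarrow> nat \<Rightarrow> nat \<Rightarrow> 'c"
  assumes \<chi>: "convex_coloring3 \<chi>" and C: "finite C" "card C \<le> K" "\<And>x y z. \<chi> x y z \<in> C"
    and n: "n \<ge> 3 * K + 2"
  shows "\<exists>S J \<rho> \<sigma>. card S = n \<and> homogeneous_blocks \<chi> S J \<rho> \<sigma> \<and>
    (\<forall>i\<in>S. J i \<subseteq> {..<n * (n ^ 6) ^ (2 * K + 1)} \<and> card (J i) \<le> n \<and>
      real n powr block_exponent K \<le> real (card (J i)))"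
proof -
  \<comment> \<open>The sixth power leaves enough children for the free set:
    \<open>n ^ 5 * (3 * K) + n ^ 2 < n ^ 6\<close> because \<open>n \<ge> 3 * K + 2\<close>.\<close>
  define w where "w = n ^ 6"
  define q where "q = 2 * K + 1"
  have w0: "w > 0" unfolding w_def using n by simp
  \<comment> \<open>\<open>Lt i a\<close> and \<open>Rt i a\<close> are the ends of the ancestor of
    leaf block \<open>i\<close> at height \<open>a\<close>; the right end is exclusive.\<close>
  define Rt where "Rt i a = (i div w ^ a + 1) * (n * w ^ a)" for i a
  define Lt where "Lt i a = (i div w ^ a) * (n * w ^ a)" for i a
  have divw: "i div w ^ Suc a = (i div w ^ a) div w" for i a
    by (simp only: power_Suc2 div_mult2_eq)
  have Rt: "mono (Rt i)" for i
  proof (rule incseq_SucI)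
    fix a
    have "i div w ^ a < w + w * (i div w ^ a div w)" by (rule dividend_less_times_div[OF w0])
    then have "i div w ^ a + 1 \<le> (i div w ^ a div w + 1) * w" by (simp add: algebra_simps)
    then have "(i div w ^ a + 1) * (n * w ^ a) \<le> (i div w ^ a div w + 1) * w * (n * w ^ a)"
      by (rule mult_right_mono) simp
    then show "Rt i a \<le> Rt i (Suc a)" unfolding Rt_def divw by (simp only: power_Suc mult_ac)
  qed
  have Lt: "antimono (Lt i)" for i
  proof (rule decseq_SucI)
    fix a
    have "i div w ^ a div w * w \<le> i div w ^ a" by simp
    then have "i div w ^ a div w * w * (n * w ^ a) \<le> i div w ^ a * (n * w ^ a)"
      by (rule mult_right_mono) simp
    then show "Lt i (Suc a) \<le> Lt i a" unfolding Lt_def divw by (simp only: power_Suc mult_ac)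
  qed
  define Q where "Q i J a \<rho> \<sigma> \<longleftrightarrow> J \<subseteq> {i * n..<(i + 1) * n} \<and> a < q \<and>
    real n powr block_exponent K \<le> real (card J) \<and>
    (\<forall>x\<in>J. \<forall>x'\<in>J. x < x' \<longrightarrow> (\<forall>y\<in>{Rt i a..Rt i (Suc a)}. \<chi> x x' y = \<rho>) \<and>
      (\<forall>y\<in>{Lt i (Suc a)..Lt i a}. \<chi> y x x' = \<sigma>))" for i J a \<rho> \<sigma>
  have "\<exists>J a \<rho> \<sigma>. Q i J a \<rho> \<sigma>" for i
  proof -
    have "card {i * n..<(i + 1) * n} = n" by simp
    then show ?thesis
      using uncut_shell[where \<chi> = \<chi> and R = "Rt i" and L = "Lt i" and X = "{i * n..<(i + 1) * n}",
          OF \<chi> C finite_atLeastLessThan Rt Lt]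
      unfolding Q_def q_def by (simp only:) (elim exE conjE, intro exI conjI, assumption+)
  qed
  then obtain Jf lev \<rho>f \<sigma>f where Q: "\<And>i. Q i (Jf i) (lev i) (\<rho>f i) (\<sigma>f i)" by metis
  have levq: "lev i < q" for i using Q[of i] unfolding Q_def by (elim conjE)
  obtain a j where a: "a < q" and "\<forall>c<w. \<exists>i<w ^ q. i div w ^ a = j * w + c \<and> lev i = a"
    using full_tree_node[where lev = lev and w = w and q = q] w0 levq by blast
  \<comment> \<open>The children of node \<open>j\<close> have the numbers \<open>j * w + c\<close>
    at height \<open>a\<close>, and \<open>\<iota> c\<close> is a leaf below child \<open>c\<close>
    whose shell has index \<open>a\<close>.\<close>
  then obtain \<iota> where \<iota>: "\<And>c. c < w \<Longrightarrow> \<iota> c < w ^ q"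
    "\<And>c. c < w \<Longrightarrow> \<iota> c div w ^ a = j * w + c" "\<And>c. c < w \<Longrightarrow> lev (\<iota> c) = a" by metis
  \<comment> \<open>This is the length of a child interval: child \<open>c\<close> starts at
    \<open>(j * w + c) * b\<close> and ends just before \<open>(j * w + c + 1) * b\<close>.\<close>
  define b where "b = n * w ^ a"
  define J where "J c = Jf (\<iota> c)" for c
  have Jsub: "J c \<subseteq> {\<iota> c * n..<(\<iota> c + 1) * n}" for c
    using Q[of "\<iota> c"] unfolding Q_def J_def by (elim conjE)
  have Jlow: "(j * w + c) * b \<le> x" and Jup: "x < (j * w + c + 1) * b" if "c < w" "x \<in> J c" for c x
  proof -
    have wa: "w ^ a > 0" using w0 by simp
    have "(j * w + c) * w ^ a \<le> \<iota> c" unfolding \<iota>(2)[OF that(1), symmetric] by simp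
    then have "(j * w + c) * w ^ a * n \<le> \<iota> c * n" by (rule mult_right_mono) simp
    also have "\<iota> c * n \<le> x" using Jsub[of c] that(2) by auto
    finally show "(j * w + c) * b \<le> x" unfolding b_def by (simp only: mult_ac)
    have "\<iota> c < w ^ a + w ^ a * (\<iota> c div w ^ a)" by (rule dividend_less_times_div[OF wa])
    then have "\<iota> c + 1 \<le> (j * w + c + 1) * w ^ a" unfolding \<iota>(2)[OF that(1)] by (simp add: algebra_simps)
    then have "(\<iota> c + 1) * n \<le> (j * w + c + 1) * w ^ a * n" by (rule mult_right_mono) simp
    moreover have "x < (\<iota> c + 1) * n" using Jsub[of c] that(2) by auto
    ultimately have "x < (j * w + c + 1) * w ^ a * n" by linarith
    then show "x < (j * w + c + 1) * b" unfolding b_def by (simp only: mult_ac)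
  qed
  have step: "(j * w + c + 1) * b \<le> (j * w + c') * b" if "c < c'" for c c'
    using that by (intro mult_right_mono) auto
  have Rta: "Rt (\<iota> c) a = (j * w + c + 1) * b" and Lta: "Lt (\<iota> c) a = (j * w + c) * b"
    and RtS: "Rt (\<iota> c) (Suc a) = (j * w + w) * b" and LtS: "Lt (\<iota> c) (Suc a) = j * w * b" if "c < w" for c
  proof -
    have "\<iota> c div w ^ Suc a = j" unfolding divw \<iota>(2)[OF that] using that by simp
    then show "Rt (\<iota> c) (Suc a) = (j * w + w) * b" "Lt (\<iota> c) (Suc a) = j * w * b"
      unfolding Rt_def Lt_def b_def by (simp_all add: algebra_simps)
    show "Rt (\<iota> c) a = (j * w + c + 1) * b" "Lt (\<iota> c) a = (j * w + c) * b"
      unfolding Rt_def Lt_def b_def \<iota>(2)[OF that] by simp_all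
  qed
  have pair: "(\<forall>y\<in>{(j * w + c + 1) * b..(j * w + w) * b}. \<chi> x x' y = \<rho>f (\<iota> c)) \<and>
      (\<forall>y\<in>{j * w * b..(j * w + c) * b}. \<chi> y x x' = \<sigma>f (\<iota> c))"
    if "c < w" "x \<in> J c" "x' \<in> J c" "x < x'" for c x x'
    using Q[of "\<iota> c"] that(2-4)
    unfolding Q_def \<iota>(3)[OF that(1)] Rta[OF that(1)] Lta[OF that(1)] RtS[OF that(1)] LtS[OF that(1)] J_def
    by simp
  have ord: "x < y" if "c < w" "d < w" "c < d" "x \<in> J c" "y \<in> J d" for c d x y
    using Jup[OF that(1,4)] step[OF that(3)] Jlow[OF that(2,5)] by linarith
  have cardJ: "card (J c) \<le> n" for c
    using card_mono[OF _ Jsub[of c]] by simp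
  have finJ: "finite (J c)" for c
    by (rule finite_subset[OF Jsub]) simp
  have right: "\<chi> x x' y = \<rho>f (\<iota> c)"
    if "c < w" "d < w" "c < d" "x \<in> J c" "x' \<in> J c" "y \<in> J d" "x < x'" for c d x x' y
  proof -
    have "(j * w + d + 1) * b \<le> (j * w + w) * b" using that by (intro mult_right_mono) auto
    then have "y \<in> {(j * w + c + 1) * b..(j * w + w) * b}"
      using step[OF that(3)] Jlow[OF that(2,6)] Jup[OF that(2,6)] by simp
    then show ?thesis using pair[OF that(1,4,5,7)] by (elim conjE) (rule bspec)
  qed
  have left: "\<chi> x y y' = \<sigma>f (\<iota> d)"
    if "c < w" "d < w" "c < d" "x \<in> J c" "y \<in> J d" "y' \<in> J d" "y < y'" for c d x y y'
  proof -
    have "j * w * b \<le> (j * w + c) * b" by (intro mult_right_mono) auto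
    then have "j * w * b \<le> x" using Jlow[OF that(1,4)] by (rule order.trans)
    then have "x \<in> {j * w * b..(j * w + d) * b}"
      using step[OF that(3)] Jlow[OF that(1,4)] Jup[OF that(1,4)] by simp
    then show ?thesis using pair[OF that(2,5,6,7)] by (elim conjE) (rule bspec)
  qed
  have large: "n ^ 3 * (n * n * (3 * K)) + n\<^sup>2 < card {..<w}"
  proof -
    have "n\<^sup>2 \<le> n ^ 5" using n by (intro power_increasing) auto
    moreover have "n ^ 5 > 0" using n by simp
    moreover have "n ^ 5 * (3 * K + 2) \<le> n ^ 5 * n" using n by (rule mult_left_mono) simp
    moreover have "n ^ 3 * (n * n * (3 * K)) = n ^ 5 * (3 * K)" by (simp add: power_numeral_reduce)
    moreover have "n ^ 5 * n = w" unfolding w_def by (simp add: power_numeral_reduce)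
    moreover have "n ^ 5 * (3 * K + 2) = n ^ 5 * (3 * K) + n ^ 5 * 2" by (rule distrib_left)
    ultimately show ?thesis unfolding card_lessThan by linarith
  qed
  have "\<exists>S\<subseteq>{..<w}. card S = n \<and> homogeneous_blocks \<chi> S J (\<lambda>c. \<rho>f (\<iota> c)) (\<lambda>c. \<sigma>f (\<iota> c))"
    by (rule homogeneous_blocks_of_uncut_blocks[OF \<chi> C finJ cardJ finite_lessThan large])
      (simp only: lessThan_iff, rule ord right left, assumption+)+
  then obtain S where S: "S \<subseteq> {..<w}" "card S = n"
    "homogeneous_blocks \<chi> S J (\<lambda>c. \<rho>f (\<iota> c)) (\<lambda>c. \<sigma>f (\<iota> c))" by (elim exE conjE) (rule that)
  have "J c \<subseteq> {..<n * w ^ q} \<and> card (J c) \<le> n \<and> real n powr block_exponent K \<le> real (card (J c))"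
    if "c \<in> S" for c
  proof (intro conjI)
    have "\<iota> c + 1 \<le> w ^ q" using \<iota>(1)[of c] that S(1) by auto
    then have "(\<iota> c + 1) * n \<le> w ^ q * n" by (rule mult_right_mono) simp
    then show "J c \<subseteq> {..<n * w ^ q}" using Jsub[of c] by (auto simp: mult.commute)
    show "card (J c) \<le> n" by (rule cardJ)
    show "real n powr block_exponent K \<le> real (card (J c))"
      using Q[of "\<iota> c"] unfolding Q_def J_def by (elim conjE)
  qed
  then have "\<forall>c\<in>S. J c \<subseteq> {..<n * w ^ q} \<and> card (J c) \<le> n \<and>
      real n powr block_exponent K \<le> real (card (J c))" by (rule ballI)
  from conjI[OF S(2) conjI[OF S(3) this]] show ?thesis unfolding w_def q_def
    by (intro exI)
qed

lemma convex_coloring_mono_reindex: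
  "convex_coloring g \<Longrightarrow> mono e \<Longrightarrow> convex_coloring (\<lambda>x. g (e x))"
  unfolding convex_coloring_def by (meson monoD)

text \<open>The result for naturals is transported along the enumeration of \<open>X\<close>. Global
  monotonicity keeps the pulled-back colouring convex, and strictness on the first
  \<open>card X\<close> indices preserves the block order and the block sizes.\<close>

lemma homogeneous_blocks_exist:
  fixes \<chi> :: "'a::linorder \<Rightarrow> 'a \<Rightarrow> 'a \<Rightarrow> 'c"
  assumes \<chi>: "convex_coloring3 \<chi>" and C: "finite C" "card C \<le> K" "\<And>x y z. \<chi> x y z \<in> C"
    and n: "n \<ge> 3 * K + 2" and X: "finite X" and large: "n * (n ^ 6) ^ (2 * K + 1) \<le> card X"
  shows "\<exists>S J \<rho> \<sigma>. card S = n \<and> homogeneous_blocks \<chi> S J \<rho> \<sigma> \<and>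
    (\<forall>i\<in>S. J i \<subseteq> X \<and> card (J i) \<le> n \<and> real n powr block_exponent K \<le> real (card (J i)))"
proof -
  have "n * (n ^ 6) ^ (2 * K + 1) > 0" using n by simp
  then have "X \<noteq> {}" using large by auto
  then obtain e :: "nat \<Rightarrow> 'a" where e: "mono e" "strict_mono_on {..<card X} e" "e ` {..<card X} = X"
    using finite_linorder_enum[OF X] by blast
  define \<chi>' where "\<chi>' x y z = \<chi> (e x) (e y) (e z)" for x y z
  have \<chi>': "convex_coloring3 \<chi>'"
    using convex_coloring3D[OF \<chi>] convex_coloring_mono_reindex[OF _ e(1)]
    unfolding convex_coloring3_def \<chi>'_def by blast
  have C': "\<chi>' x y z \<in> C" for x y z unfolding \<chi>'_def by (rule C)
  obtain S J \<rho> \<sigma> where S: "card S = n" "homogeneous_blocks \<chi>' S J \<rho> \<sigma>"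
    "\<forall>i\<in>S. J i \<subseteq> {..<n * (n ^ 6) ^ (2 * K + 1)} \<and> card (J i) \<le> n \<and>
      real n powr block_exponent K \<le> real (card (J i))"
    using homogeneous_blocks_nat[where \<chi> = \<chi>', OF \<chi>' C(1,2) C' n] by (elim exE conjE) (rule that)
  have Jsub: "J i \<subseteq> {..<card X}" if "i \<in> S" for i
  proof -
    have "J i \<subseteq> {..<n * (n ^ 6) ^ (2 * K + 1)}" using S(3) that by blast
    also have "\<dots> \<subseteq> {..<card X}" using large by (intro lessThan_subset_iff[THEN iffD2])
    finally show ?thesis .
  qed
  have less: "x < y" if "e x < e y" for x y
    using that monoD[OF e(1), of y x] by (meson not_le)
  have H: "homogeneous_blocks \<chi> S (\<lambda>i. e ` J i) \<rho> \<sigma>"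
  proof (rule homogeneous_blocksI)
    fix i j assume ij: "i \<in> S" "j \<in> S" "i < j"
    note D = homogeneous_blocksD[OF S(2) ij]
    show "x < y" if xy: "x \<in> e ` J i" "y \<in> e ` J j" for x y
    proof -
      obtain u v where uv: "x = e u" "u \<in> J i" "y = e v" "v \<in> J j" using xy by blast
      show ?thesis unfolding uv(1,3)
        using D(1)[OF uv(2,4)] uv Jsub[OF ij(1)] Jsub[OF ij(2)]
        by (intro strict_mono_onD[OF e(2)]) auto
    qed
    show "\<chi> x x' y = \<rho> i" if xy: "x \<in> e ` J i" "x' \<in> e ` J i" "y \<in> e ` J j" "x < x'" for x x' y
    proof -
      obtain u u' v where uv: "x = e u" "u \<in> J i" "x' = e u'" "u' \<in> J i" "y = e v" "v \<in> J j" using xy by blast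
      then show ?thesis using D(2)[of u u' v] less[of u u'] xy(4) by (simp add: \<chi>'_def)
    qed
    show "\<chi> x y y' = \<sigma> j" if xy: "x \<in> e ` J i" "y \<in> e ` J j" "y' \<in> e ` J j" "y < y'" for x y y'
    proof -
      obtain u v v' where uv: "x = e u" "u \<in> J i" "y = e v" "v \<in> J j" "y' = e v'" "v' \<in> J j" using xy by blast
      then show ?thesis using D(3)[of u v v'] less[of v v'] xy(4) by (simp add: \<chi>'_def)
    qed
    fix k assume k: "k \<in> S" "j < k"
    show "\<chi> x y z = \<chi> x' y' z'"
      if xy: "x \<in> e ` J i" "x' \<in> e ` J i" "y \<in> e ` J j" "y' \<in> e ` J j" "z \<in> e ` J k" "z' \<in> e ` J k" for x x' y y' z z'
    proof -
      obtain u u' v v' t t' where uv: "x = e u" "u \<in> J i" "x' = e u'" "u' \<in> J i" "y = e v" "v \<in> J j"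
        "y' = e v'" "v' \<in> J j" "z = e t" "t \<in> J k" "z' = e t'" "t' \<in> J k" using xy by blast
      show ?thesis using D(4)[OF k uv(2,4,6,8,10,12)] unfolding uv(1,3,5,7,9,11) \<chi>'_def .
    qed
  qed
  have "e ` J i \<subseteq> X \<and> card (e ` J i) \<le> n \<and> real n powr block_exponent K \<le> real (card (e ` J i))"
    if "i \<in> S" for i
  proof -
    have "inj_on e (J i)" using strict_mono_on_imp_inj_on[OF e(2)] Jsub[OF that] by (rule inj_on_subset)
    then have "card (e ` J i) = card (J i)" by (rule card_image)
    moreover have "e ` J i \<subseteq> X" using image_mono[OF Jsub[OF that], of e] e(3) by simp
    ultimately show ?thesis using S(3) that by auto
  qed
  then have "\<forall>i\<in>S. e ` J i \<subseteq> X \<and> card (e ` J i) \<le> n \<and>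
      real n powr block_exponent K \<le> real (card (e ` J i))" by (rule ballI)
  from conjI[OF S(1) conjI[OF H this]] show ?thesis
    by (rule exI[of _ \<sigma>, THEN exI[of _ \<rho>, THEN exI[of _ "\<lambda>i. e ` J i", THEN exI[of _ S]]]])
qed

subsection \<open>Independent sets\<close>

definition clique_free3 :: "('a::linorder \<Rightarrow> 'a \<Rightarrow> 'a \<Rightarrow> bool) \<Rightarrow> 'a set \<Rightarrow> nat \<Rightarrow> bool" where
  "clique_free3 E X s \<longleftrightarrow>
    (\<forall>T\<subseteq>X. card T = s \<longrightarrow> (\<exists>x\<in>T. \<exists>y\<in>T. \<exists>z\<in>T. x < y \<and> y < z \<and> \<not> E x y z))"

definition independent_set3 :: "('a::linorder \<Rightarrow> 'a \<Rightarrow> 'a \<Rightarrow> bool) \<Rightarrow> 'a set \<Rightarrow> bool" where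
  "independent_set3 E P \<longleftrightarrow> (\<forall>x\<in>P. \<forall>y\<in>P. \<forall>z\<in>P. x < y \<longrightarrow> y < z \<longrightarrow> \<not> E x y z)"

lemma independent_set3D: "independent_set3 E P \<Longrightarrow> x \<in> P \<Longrightarrow> y \<in> P \<Longrightarrow> z \<in> P \<Longrightarrow> x < y \<Longrightarrow> y < z \<Longrightarrow> \<not> E x y z"
  unfolding independent_set3_def by simp

lemma clique_free3_subset: "clique_free3 E X s \<Longrightarrow> Y \<subseteq> X \<Longrightarrow> clique_free3 E Y s"
  unfolding clique_free3_def by (intro allI impI) (drule spec, drule mp, erule (1) order.trans, simp)

lemma clique_free3_pos: "clique_free3 E X s \<Longrightarrow> s > 0"
  unfolding clique_free3_def by (rule ccontr) (auto dest: spec[of _ "{}"])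

lemma independent_if_card_le_2:
  assumes "finite P" "card P \<le> 2"
  shows "independent_set3 E P"
  unfolding independent_set3_def
proof (intro ballI impI)
  fix x y z assume "x \<in> P" "y \<in> P" "z \<in> P" "x < y" "y < z"
  from less_trans[OF \<open>x < y\<close> \<open>y < z\<close>] have "x \<noteq> z" by simp
  then have "card {x, y, z} = 3" "{x, y, z} \<subseteq> P"
    using \<open>x < y\<close> \<open>y < z\<close> \<open>x \<in> P\<close> \<open>y \<in> P\<close> \<open>z \<in> P\<close> by auto
  then show "\<not> E x y z" using card_mono[OF assms(1), of "{x, y, z}"] assms(2) by simp
qed

text \<open>A clique of size \<open>s\<close> in \<open>J\<close> would extend by \<open>y\<close>
  to one of size \<open>Suc s\<close>: as \<open>y\<close> lies on one side of \<open>J\<close>, a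
  triple containing it consists of \<open>y\<close> and a pair from \<open>J\<close>, so it is an
  edge.\<close>

lemma clique_free3_link:
  assumes X: "clique_free3 E X (Suc s)" and J: "J \<subseteq> X" "finite J" "y \<in> X"
    and link: "(\<forall>x\<in>J. x < y) \<and> (\<forall>x\<in>J. \<forall>x'\<in>J. x < x' \<longrightarrow> E x x' y) \<or>
      (\<forall>x\<in>J. y < x) \<and> (\<forall>x\<in>J. \<forall>x'\<in>J. x < x' \<longrightarrow> E y x x')"
  shows "clique_free3 E J s"
  unfolding clique_free3_def
proof (intro allI impI)
  fix T assume T: "T \<subseteq> J" "card T = s"
  have "y \<notin> T" using link T(1) by auto
  then have "card (insert y T) = Suc s" using T J(2) by (simp add: finite_subset)
  moreover have "insert y T \<subseteq> X" using T J by auto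
  ultimately obtain a b c where abc: "a \<in> insert y T" "b \<in> insert y T" "c \<in> insert y T" "a < b" "b < c" "\<not> E a b c"
    using X unfolding clique_free3_def by blast
  from link have "a \<in> T \<and> b \<in> T \<and> c \<in> T"
  proof (elim disjE conjE)
    assume *: "\<forall>x\<in>J. x < y" "\<forall>x\<in>J. \<forall>x'\<in>J. x < x' \<longrightarrow> E x x' y"
    have "u < y \<or> u = y" if "u \<in> insert y T" for u using that * T by auto
    then have "a \<noteq> y" "b \<noteq> y" using abc by (force dest: less_trans)+
    moreover from this have "c \<noteq> y" using abc * T by auto
    ultimately show ?thesis using abc by auto
  next
    assume *: "\<forall>x\<in>J. y < x" "\<forall>x\<in>J. \<forall>x'\<in>J. x < x' \<longrightarrow> E y x x'"
    have "y < u \<or> u = y" if "u \<in> insert y T" for u using that * T by auto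
    then have "c \<noteq> y" "b \<noteq> y" using abc by (force dest: less_trans)+
    moreover from this have "a \<noteq> y" using abc * T by auto
    ultimately show ?thesis using abc by auto
  qed
  then show "\<exists>x\<in>T. \<exists>y\<in>T. \<exists>z\<in>T. x < y \<and> y < z \<and> \<not> E x y z" using abc by blast
qed

text \<open>A triple of the union lies in one block, has exactly two points in one block, or is
  transversal. The first kind is handled by the sets \<open>Q i\<close>, the second by the pair
  colours, and a transversal triple has the colour of the corresponding representatives.\<close>

lemma independent_Union_blocks:
  assumes H: "homogeneous_blocks \<chi> S J \<rho> \<sigma>"
    and rep: "\<And>i. i \<in> S \<Longrightarrow> y i \<in> J i"
    and colors: "\<And>i j. i \<in> S \<Longrightarrow> j \<in> S \<Longrightarrow> i < j \<Longrightarrow> \<rho> i \<notin> C0 \<and> \<sigma> j \<notin> C0"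
    and S': "S' \<subseteq> S" "independent_set3 (\<lambda>x y z. \<chi> x y z \<in> C0) (y ` S')"
    and Q: "\<And>i. i \<in> S' \<Longrightarrow> Q i \<subseteq> J i \<and> independent_set3 (\<lambda>x y z. \<chi> x y z \<in> C0) (Q i)"
  shows "independent_set3 (\<lambda>x y z. \<chi> x y z \<in> C0) (\<Union>i\<in>S'. Q i)"
  unfolding independent_set3_def
proof (intro ballI impI)
  fix a b c assume "a \<in> (\<Union>i\<in>S'. Q i)" "b \<in> (\<Union>i\<in>S'. Q i)" "c \<in> (\<Union>i\<in>S'. Q i)" and less: "a < b" "b < c"
  then obtain i j k where ijk: "i \<in> S'" "a \<in> Q i" "j \<in> S'" "b \<in> Q j" "k \<in> S'" "c \<in> Q k" by blast
  have inS: "i \<in> S" "j \<in> S" "k \<in> S" using ijk S' by auto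
  have inJ: "a \<in> J i" "b \<in> J j" "c \<in> J k" using ijk Q by blast+
  have "i \<le> j" using homogeneous_blocksD(1)[OF H inS(2,1) _ inJ(2,1)] less(1) by (meson not_le order.asym)
  moreover have "j \<le> k" using homogeneous_blocksD(1)[OF H inS(3,2) _ inJ(3,2)] less(2) by (meson not_le order.asym)
  ultimately consider "i = j" "j = k" | "i = j" "j < k" | "i < j" "j = k" | "i < j" "j < k" by linarith
  then show "\<chi> a b c \<notin> C0"
  proof cases
    case 1
    then show ?thesis using Q[OF ijk(1)] ijk less by (auto dest: independent_set3D)
  next
    case 2
    then have "\<chi> a b c = \<rho> i" using homogeneous_blocksD(2)[OF H inS(2,3), of a b c] inJ less by simp
    then show ?thesis using colors[OF inS(2,3)] 2 by simp
  next
    case 3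
    then have "\<chi> a b c = \<sigma> j" using homogeneous_blocksD(3)[OF H inS(1,2), of a b c] inJ less by simp
    then show ?thesis using colors[OF inS(1,2)] 3 by simp
  next
    case 4
    have "\<chi> a b c = \<chi> (y i) (y j) (y k)"
      by (rule homogeneous_blocksD(4)[OF H inS(1,2) 4(1) inS(3) 4(2)]) (use inJ rep inS in auto)
    moreover have "\<chi> (y i) (y j) (y k) \<notin> C0"
      by (rule independent_set3D[OF S'(2)])
        (use ijk homogeneous_blocksD(1)[OF H inS(1,2) 4(1)] homogeneous_blocksD(1)[OF H inS(2,3) 4(2)] rep inS in auto)
    ultimately show ?thesis by simp
  qed
qed

text \<open>The block whose pair colour is an edge colour loses one in the clique bound, with any
  point of the other block serving as \<open>y\<close> in \<open>clique_free3_link\<close>.\<close>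

lemma clique_free3_block:
  assumes H: "homogeneous_blocks \<chi> S J \<rho> \<sigma>" and X: "clique_free3 (\<lambda>x y z. \<chi> x y z \<in> C0) X (Suc s)"
    and J: "\<And>i. i \<in> S \<Longrightarrow> J i \<subseteq> X \<and> finite (J i) \<and> J i \<noteq> {}"
    and ij: "i \<in> S" "j \<in> S" "i < j" "\<rho> i \<in> C0 \<or> \<sigma> j \<in> C0"
  shows "\<exists>k\<in>S. clique_free3 (\<lambda>x y z. \<chi> x y z \<in> C0) (J k) s"
  using ij(4)
proof
  assume \<rho>: "\<rho> i \<in> C0"
  obtain y where y: "y \<in> J j" using J[OF ij(2)] by blast
  have "clique_free3 (\<lambda>x y z. \<chi> x y z \<in> C0) (J i) s"
    by (rule clique_free3_link[OF X, of _ y])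
      (use J ij y \<rho> homogeneous_blocksD(1,2)[OF H ij(1-3)] in auto)
  then show ?thesis using ij by blast
next
  assume \<sigma>: "\<sigma> j \<in> C0"
  obtain y where y: "y \<in> J i" using J[OF ij(1)] by blast
  have "clique_free3 (\<lambda>x y z. \<chi> x y z \<in> C0) (J j) s"
    by (rule clique_free3_link[OF X, of _ y])
      (use J ij y \<sigma> homogeneous_blocksD(1,3)[OF H ij(1-3)] in auto)
  then show ?thesis using ij by blast
qed

section \<open>The recursion for the size of an independent set\<close>

text \<open>With \<open>v ^ (2 * d) = N\<close> the choice is \<open>v ^ 2\<close> rounded down. Its
  \<open>d\<close>-th power is at most \<open>N\<close>, and since \<open>v \<ge> 2\<close> the
  rounding does not take it below \<open>v\<close>.\<close>

lemma block_number_exists: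
  fixes N d m :: nat
  assumes "d \<ge> 1" and N: "N \<ge> (m + 2) ^ (2 * d)"
  shows "\<exists>n\<ge>m. n \<ge> 2 \<and> n ^ d \<le> N \<and> real N powr (1 / (2 * real d)) \<le> real n"
proof -
  define v where "v = real N powr (1 / (2 * real d))"
  have N0: "N > 0" using N by (rule less_le_trans[rotated]) simp
  have vN: "v ^ (2 * d) = real N"
    unfolding v_def using N0 assms(1) by (simp add: powr_realpow[symmetric] powr_powr)
  have v0: "v \<ge> 0" unfolding v_def by simp
  have "real (m + 2) ^ (2 * d) \<le> v ^ (2 * d)" unfolding vN using N by (metis of_nat_le_iff of_nat_power)
  then have vm: "real (m + 2) \<le> v" using v0 assms(1) by (simp add: power_mono_iff)
  define n where "n = nat \<lfloor>v\<^sup>2\<rfloor>"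
  have nv: "real n \<le> v\<^sup>2" unfolding n_def by (simp add: of_nat_floor)
  have "v * 2 \<le> v * v" using vm by (intro mult_left_mono) auto
  moreover have "v\<^sup>2 < real n + 1" unfolding n_def by linarith
  ultimately have vn: "v \<le> real n" using vm unfolding power2_eq_square by linarith
  have "real n ^ d \<le> (v\<^sup>2) ^ d" by (rule power_mono[OF nv]) simp
  also have "\<dots> = real N" using vN by (simp add: power_mult)
  finally have "n ^ d \<le> N" by (metis of_nat_le_iff of_nat_power)
  moreover have "n \<ge> m + 2" using vm vn by linarith
  ultimately show ?thesis using vn unfolding v_def[symmetric] by (intro exI[of _ n]) auto
qed

lemma large_independent_set:
  fixes K :: nat
  shows "\<exists>\<epsilon> \<alpha> :: real. 0 < \<epsilon> \<and> \<epsilon> < 1 \<and> 0 < \<alpha> \<and> \<alpha> < 1 \<and>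
    (\<forall>(\<chi> :: 'a::linorder \<Rightarrow> 'a \<Rightarrow> 'a \<Rightarrow> 'c) C C0 s X.
      convex_coloring3 \<chi> \<longrightarrow> finite C \<longrightarrow> card C \<le> K \<longrightarrow> (\<forall>x y z. \<chi> x y z \<in> C) \<longrightarrow>
      finite X \<longrightarrow> X \<noteq> {} \<longrightarrow> clique_free3 (\<lambda>x y z. \<chi> x y z \<in> C0) X s \<longrightarrow>
      (\<exists>P\<subseteq>X. independent_set3 (\<lambda>x y z. \<chi> x y z \<in> C0) P \<and>
        exp (\<alpha> powr (\<epsilon> * real s) * ln (real (card X)) powr \<epsilon>) \<le> real (card P)))"
proof -
  \<comment> \<open>\<open>homogeneous_blocks_exist\<close> needs \<open>n ^ d\<close> points. From
    \<open>N0\<close> points on, \<open>block_number_exists\<close> supplies such an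
    \<open>n\<close> with \<open>n \<ge> 3 * K + 2\<close>.\<close>
  define d where "d = 6 * (2 * K + 1) + 1"
  define N0 where "N0 = (3 * K + 2 + 2) ^ (2 * d)"
  \<comment> \<open>Every block has at least \<open>N powr c\<close> points: the choice of
    \<open>n\<close> costs the exponent \<open>1 / (2 * d)\<close>, the passage to a subset of the
    block costs \<open>block_exponent K\<close>. Then \<open>\<epsilon>\<close> solves
    \<open>c powr \<epsilon> = 1 / 2\<close>.\<close>
  define c where "c = block_exponent K / (2 * real d)"
  define \<epsilon> where "\<epsilon> = ln 2 / ln (1 / c)"
  \<comment> \<open>The bound by \<open>c\<close> pays for lowering the clique size by one. The
    other bound makes the guaranteed size at most 2 for sets of fewer than \<open>N0\<close>
    points.\<close>
  define \<alpha> where "\<alpha> = min c (ln 2 powr (1 / \<epsilon>) / ln (real N0))"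
  have d7: "d \<ge> 7" unfolding d_def by simp
  have c: "0 < c" "c \<le> 1 / (2 * real d)" "c < 1 / 2"
  proof -
    show "0 < c" unfolding c_def using block_exponent_bounds(1)[of K] d7 by (intro divide_pos_pos) auto
    show c2: "c \<le> 1 / (2 * real d)" unfolding c_def using block_exponent_bounds(2)[of K] by (intro divide_right_mono) auto
    have "1 / (2 * real d) < 1 / 2" using d7 by (simp add: field_simps)
    then show "c < 1 / 2" using c2 by linarith
  qed
  have lnc: "ln 2 < ln (1 / c)" using c by (intro ln_less_cancel_iff[THEN iffD2]) (auto simp: field_simps)
  have ln2: "ln 2 > (0 :: real)" by simp
  have \<epsilon>: "0 < \<epsilon>" "\<epsilon> < 1"
    unfolding \<epsilon>_def using lnc ln2 by (simp_all only: divide_pos_pos less_trans[OF ln2 lnc] divide_less_eq_1_pos)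
  have ceps: "c powr \<epsilon> = 1 / 2"
  proof -
    have "\<epsilon> * ln c = - ln 2" unfolding \<epsilon>_def using lnc ln2 c by (simp add: ln_div)
    then show ?thesis using c by (simp add: powr_def exp_minus)
  qed
  have "N0 \<ge> 2 ^ 1" unfolding N0_def
    by (rule order.trans[OF power_increasing[of 1 "2 * d"] power_mono]) (use d7 in auto)
  then have lnN0: "ln (real N0) > 0" by (intro ln_gt_zero) simp
  have \<alpha>: "0 < \<alpha>" "\<alpha> < 1" "\<alpha> \<le> c" "\<alpha> * ln (real N0) \<le> ln 2 powr (1 / \<epsilon>)"
  proof -
    show "0 < \<alpha>" unfolding \<alpha>_def using c lnN0 by simp
    show "\<alpha> \<le> c" unfolding \<alpha>_def by simp
    then show "\<alpha> < 1" using c by linarith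
    have "\<alpha> \<le> ln 2 powr (1 / \<epsilon>) / ln (real N0)" unfolding \<alpha>_def by simp
    then show "\<alpha> * ln (real N0) \<le> ln 2 powr (1 / \<epsilon>)" using lnN0 by (simp add: pos_le_divide_eq)
  qed
  define B where "B s x = \<alpha> powr (\<epsilon> * real s) * ln (real x) powr \<epsilon>" for s x :: nat
  have main: "\<exists>P\<subseteq>X. independent_set3 (\<lambda>x y z. \<chi> x y z \<in> C0) P \<and> exp (B s (card X)) \<le> real (card P)"
    if \<chi>: "convex_coloring3 \<chi>" and C: "finite C" "card C \<le> K" "\<And>x y z. \<chi> x y z \<in> C"
      and X: "finite X" "X \<noteq> {}" "clique_free3 (\<lambda>x y z. \<chi> x y z \<in> C0) X s"
    for \<chi> :: "'a \<Rightarrow> 'a \<Rightarrow> 'a \<Rightarrow> 'c" and C C0 s X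
    using X
  proof (induction "card X" arbitrary: X s rule: less_induct)
    case less
    let ?E = "\<lambda>x y z. \<chi> x y z \<in> C0"
    define N where "N = card X"
    have s0: "s > 0" using clique_free3_pos[OF less.prems(3)] .
    have N1: "N \<ge> 1" unfolding N_def using less.prems by (simp add: Suc_le_eq card_gt_0_iff)
    consider "N = 1" | "2 \<le> N" "N < N0" | "N \<ge> N0" using N1 by linarith
    then have "\<exists>P\<subseteq>X. independent_set3 ?E P \<and> exp (B s N) \<le> real (card P)"
    proof cases
      case 1
      then have "B s N = 0" unfolding B_def by simp
      then show ?thesis using independent_if_card_le_2[of X ?E] less.prems 1 unfolding N_def
        by (intro exI[of _ X]) simp
    next
      case 2
      obtain P where P: "P \<subseteq> X" "card P = 2" using obtain_subset_with_card_n[of 2 X] 2 unfolding N_def by blast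
      have "\<alpha> powr (\<epsilon> * real s) \<le> \<alpha> powr \<epsilon>"
        using \<alpha> \<epsilon> s0 by (intro powr_mono') (auto simp: mult_le_cancel_left1)
      moreover have "ln (real N) powr \<epsilon> \<le> ln (real N0) powr \<epsilon>"
        using 2 \<epsilon> by (intro powr_mono2) auto
      ultimately have "B s N \<le> \<alpha> powr \<epsilon> * ln (real N0) powr \<epsilon>"
        unfolding B_def by (intro mult_mono) auto
      also have "\<dots> = (\<alpha> * ln (real N0)) powr \<epsilon>" using \<alpha> lnN0 by (simp add: powr_mult)
      also have "\<dots> \<le> (ln 2 powr (1 / \<epsilon>)) powr \<epsilon>" using \<alpha> \<epsilon> lnN0 by (intro powr_mono2) auto
      also have "\<dots> = ln 2" using \<epsilon> by (simp add: powr_powr)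
      finally have "exp (B s N) \<le> exp (ln 2)" by (simp only: exp_le_cancel_iff)
      moreover have "independent_set3 ?E P" using P less.prems by (intro independent_if_card_le_2) (auto intro: finite_subset)
      ultimately show ?thesis using P by (intro exI[of _ P]) simp
    next
      case 3
      have "d \<ge> 1" using d7 by simp
      from block_number_exists[OF this 3[unfolded N0_def]] obtain n where
        n: "n \<ge> 3 * K + 2" "n \<ge> 2" "n ^ d \<le> N" "real N powr (1 / (2 * real d)) \<le> real n" by blast
      have nd: "n * (n ^ 6) ^ (2 * K + 1) = n ^ d" unfolding d_def by (simp only: power_mult power_add power_one_right mult.commute)
      \<comment> \<open>The induction hypothesis is applied to the blocks and also to the set of
        \<open>n\<close> representatives, so both must be smaller than \<open>X\<close>.\<close>
      have nN: "n < N"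
      proof -
        have "n ^ 1 < n ^ d" using n d7 by (intro power_strict_increasing) auto
        then show ?thesis using n(3) by simp
      qed
      obtain S J \<rho> \<sigma> where S: "card S = n" and H: "homogeneous_blocks \<chi> S J \<rho> \<sigma>"
        and J: "\<forall>i\<in>S. J i \<subseteq> X \<and> card (J i) \<le> n \<and> real n powr block_exponent K \<le> real (card (J i))"
        using homogeneous_blocks_exist[where \<chi> = \<chi>, OF \<chi> C n(1) less.prems(1), unfolded nd, OF n(3)[unfolded N_def]]
        by (elim exE conjE) (rule that)
      have NR: "real N > 0" using N1 by simp
      have lnN: "ln (real N) \<ge> 0" using N1 by simp
      \<comment> \<open>Passing to \<open>N powr c\<close> points multiplies the logarithm by
        \<open>c\<close>, and hence its \<open>\<epsilon>\<close>-th power by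
        \<open>c powr \<epsilon> = 1 / 2\<close>.\<close>
      have grow: "ln (real N) powr \<epsilon> / 2 \<le> ln (real M) powr \<epsilon>" if "real N powr c \<le> real M" for M :: nat
      proof -
        have "ln (real N powr c) \<le> ln (real M)"
        proof (rule ln_mono)
          show p: "0 < real N powr c" using NR by simp
          show "real N powr c \<le> real M" by (rule that)
        qed
        then have "c * ln (real N) \<le> ln (real M)" using NR by (simp add: ln_powr)
        then have "(c * ln (real N)) powr \<epsilon> \<le> ln (real M) powr \<epsilon>" using c lnN \<epsilon> by (intro powr_mono2) auto
        then show ?thesis using c lnN ceps by (simp add: powr_mult)
      qed
      have Nn: "real N powr c \<le> real n"
        by (rule order.trans[OF powr_mono n(4)]) (use c N1 in auto)
      have NJ: "real N powr c \<le> real (card (J i))" if "i \<in> S" for i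
      proof -
        have "real N powr c = (real N powr (1 / (2 * real d))) powr block_exponent K"
          unfolding c_def by (simp add: powr_powr)
        also have "\<dots> \<le> real n powr block_exponent K"
          using n(4) block_exponent_bounds(1)[of K] by (intro powr_mono2) auto
        finally show ?thesis using J that by force
      qed
      have Npos: "0 < real N powr c" using NR by simp
      have J': "J i \<subseteq> X" "finite (J i)" "J i \<noteq> {}" "card (J i) < card X" if "i \<in> S" for i
      proof -
        show "J i \<subseteq> X" using J that by blast
        then show "finite (J i)" using less.prems(1) by (rule finite_subset)
        show "J i \<noteq> {}" using NJ[OF that] Npos by auto
        show "card (J i) < card X" using J that nN unfolding N_def by fastforce
      qed
      show ?thesis
      proof (cases "\<exists>i\<in>S. \<exists>j\<in>S. i < j \<and> (\<rho> i \<in> C0 \<or> \<sigma> j \<in> C0)")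
        case True
        then obtain i j where ij: "i \<in> S" "j \<in> S" "i < j" "\<rho> i \<in> C0 \<or> \<sigma> j \<in> C0" by blast
        obtain s' where s': "s = Suc s'" using s0 by (cases s) auto
        obtain k where k: "k \<in> S" "clique_free3 ?E (J k) s'"
          using clique_free3_block[OF H less.prems(3)[unfolded s'] _ ij] J' by blast
        obtain P where P: "P \<subseteq> J k" "independent_set3 ?E P" "exp (B s' (card (J k))) \<le> real (card P)"
          using less.hyps[OF J'(4)[OF k(1)] J'(2,3)[OF k(1)] k(2)] by blast
        \<comment> \<open>The bound for \<open>s\<close> carries one more factor
          \<open>\<alpha> powr \<epsilon>\<close> than the bound for \<open>s'\<close>. This factor
          is at most \<open>1 / 2\<close> and absorbs the loss in \<open>grow\<close>.\<close>
        have "B s N = \<alpha> powr (\<epsilon> * real s') * (\<alpha> powr \<epsilon> * ln (real N) powr \<epsilon>)"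
          unfolding B_def s' by (simp add: algebra_simps powr_add)
        also have "\<dots> \<le> \<alpha> powr (\<epsilon> * real s') * (c powr \<epsilon> * ln (real N) powr \<epsilon>)"
          using \<alpha> \<epsilon> by (intro mult_left_mono mult_right_mono powr_mono2) auto
        also have "\<dots> \<le> B s' (card (J k))"
          unfolding B_def ceps using grow[OF NJ[OF k(1)]] by (intro mult_left_mono) auto
        finally have "exp (B s N) \<le> real (card P)" using P(3) by (meson exp_le_cancel_iff order.trans)
        then show ?thesis using P J'(1)[OF k(1)] by blast
      next
        case False
        then have colors: "\<rho> i \<notin> C0 \<and> \<sigma> j \<notin> C0" if "i \<in> S" "j \<in> S" "i < j" for i j using that by blast
        have "\<forall>i\<in>S. \<exists>y. y \<in> J i" using J'(3) by blast
        from bchoice[OF this] obtain y where y: "\<forall>i\<in>S. y i \<in> J i" by (elim exE) (rule that)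
        have disj: "u < v" if "i \<in> S" "j \<in> S" "i < j" "u \<in> J i" "v \<in> J j" for i j u v
          by (rule homogeneous_blocksD(1)[OF H that])
        have injy: "inj_on y S"
        proof (rule inj_onI, rule ccontr)
          fix i j assume "i \<in> S" "j \<in> S" "y i = y j" "i \<noteq> j"
          then show False using disj[of i j "y i" "y j"] disj[of j i "y j" "y i"] y by (cases i j rule: linorder_cases) auto
        qed
        have cT: "card (y ` S) = n" using card_image[OF injy] S by simp
        have finS: "finite S" using S n(2) by (intro card_ge_0_finite) simp
        have TX: "y ` S \<subseteq> X" using y J'(1) by blast
        have "y ` S \<noteq> {}" using cT n(2) by auto
        then obtain T where T: "T \<subseteq> y ` S" "independent_set3 ?E T" "exp (B s n) \<le> real (card T)"
          using less.hyps[OF _ _ _ clique_free3_subset[OF less.prems(3) TX]] nN finS unfolding cT N_def by blast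
        obtain S' where S': "S' \<subseteq> S" "T = y ` S'" using T(1) by (meson subset_imageE)
        have "\<forall>i\<in>S. \<exists>P. P \<subseteq> J i \<and> independent_set3 ?E P \<and> exp (B s (card (J i))) \<le> real (card P)"
        proof
          fix i assume i: "i \<in> S"
          show "\<exists>P. P \<subseteq> J i \<and> independent_set3 ?E P \<and> exp (B s (card (J i))) \<le> real (card P)"
            by (rule less.hyps[OF J'(4)[OF i] J'(2,3)[OF i] clique_free3_subset[OF less.prems(3) J'(1)[OF i]]])
        qed
        from bchoice[OF this] obtain Q where
          Q: "\<forall>i\<in>S. Q i \<subseteq> J i \<and> independent_set3 ?E (Q i) \<and> exp (B s (card (J i))) \<le> real (card (Q i))"
          by (elim exE) (rule that)
        \<comment> \<open>The number of selected blocks and the size of each \<open>Q i\<close> are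
          both at least \<open>exp b\<close>, so the disjoint union has at least
          \<open>exp b * exp b\<close> points.\<close>
        define b where "b = B s N / 2"
        have B: "b \<le> B s M" if "real N powr c \<le> real M" for M
          using mult_left_mono[OF grow[OF that], of "\<alpha> powr (\<epsilon> * real s)"] unfolding b_def B_def by simp
        have ind: "independent_set3 ?E (\<Union>i\<in>S'. Q i)"
          by (rule independent_Union_blocks[OF H]) (use y colors S' T(2) Q in auto)
        have "exp (B s N) = exp b * exp b" unfolding b_def by (simp add: exp_add[symmetric])
        also have "\<dots> \<le> real (card S') * exp b"
        proof (rule mult_right_mono)
          have "card T = card S'" unfolding S'(2) by (rule card_image[OF inj_on_subset[OF injy S'(1)]])
          moreover have "exp b \<le> exp (B s n)" using B[OF Nn] by simp
          ultimately show "exp b \<le> real (card S')" using T(3) by linarith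
        qed simp
        also have "\<dots> = (\<Sum>i\<in>S'. exp b)" by simp
        also have "\<dots> \<le> (\<Sum>i\<in>S'. real (card (Q i)))"
        proof (rule sum_mono)
          fix i assume "i \<in> S'"
          then have i: "i \<in> S" using S' by blast
          have "exp b \<le> exp (B s (card (J i)))" using B[OF NJ[OF i]] by simp
          then show "exp b \<le> real (card (Q i))" using bspec[OF Q i] by linarith
        qed
        also have "\<dots> = real (card (\<Union>i\<in>S'. Q i))"
        proof -
          have "card (\<Union>i\<in>S'. Q i) = (\<Sum>i\<in>S'. card (Q i))"
          proof (rule card_UN_disjoint)
            show "finite S'" using S'(1) finS by (rule finite_subset)
            show "\<forall>i\<in>S'. finite (Q i)" using Q S'(1) J'(2) by (meson finite_subset subsetD)
            show "\<forall>i\<in>S'. \<forall>j\<in>S'. i \<noteq> j \<longrightarrow> Q i \<inter> Q j = {}"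
            proof (intro ballI impI equals0I)
              fix i j u assume *: "i \<in> S'" "j \<in> S'" "i \<noteq> j" "u \<in> Q i \<inter> Q j"
              then have "i \<in> S" "j \<in> S" "u \<in> J i" "u \<in> J j" using S'(1) Q by blast+
              then show False using disj[of i j u u] disj[of j i u u] *(3) by (cases i j rule: linorder_cases) auto
            qed
          qed
          then show ?thesis by simp
        qed
        finally have "exp (B s N) \<le> real (card (\<Union>i\<in>S'. Q i))" .
        moreover have "(\<Union>i\<in>S'. Q i) \<subseteq> X" using Q S'(1) J'(1) by blast
        ultimately show ?thesis using ind by blast
      qed
    qed
    then show ?case unfolding N_def .
  qed
  show ?thesis
    by (rule exI[of _ \<epsilon>], rule exI[of _ \<alpha>], intro conjI \<epsilon> \<alpha>(1,2) allI impI)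
      (rule main[unfolded B_def]; (assumption | erule allE)+)
qed

subsection \<open>Sign patterns of polynomials\<close>

lemma higher_pderiv_eq_0:
  fixes p :: "real poly"
  assumes "degree p < m"
  shows "(pderiv ^^ m) p = 0"
proof (rule poly_eqI)
  fix n
  have "coeff p (n + m) = 0" using assms by (intro coeff_eq_0) simp
  then show "coeff ((pderiv ^^ m) p) n = coeff 0 n" by (simp add: coeff_higher_pderiv)
qed

lemma sgn_eq_between:
  fixes a b u :: real
  assumes "sgn a = sgn b" "a \<le> u \<and> u \<le> b \<or> b \<le> u \<and> u \<le> a"
  shows "sgn u = sgn a"
  using assms by (auto simp: sgn_if split: if_splits)

text \<open>Thom's lemma: on the cell cut out by the signs of the derivatives, the polynomial is monotone.\<close>
lemma Thom_lemma:
  fixes p :: "real poly"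
  assumes "(pderiv ^^ Suc t) p = 0" "x \<le> u" "u \<le> y"
    and "\<And>a. a \<le> t \<Longrightarrow> sgn (poly ((pderiv ^^ a) p) x) = sgn (poly ((pderiv ^^ a) p) y)"
    and "a \<le> t"
  shows "sgn (poly ((pderiv ^^ a) p) u) = sgn (poly ((pderiv ^^ a) p) x)"
  using assms
proof (induction t arbitrary: p u a)
  case 0
  then have "degree p = 0" by (simp add: pderiv_eq_0_iff)
  then obtain h where "p = [:h:]" by (rule degree_eq_zeroE)
  then show ?case using 0 by simp
next
  case (Suc t)
  have shift: "(pderiv ^^ n) (pderiv p) = (pderiv ^^ Suc n) p" for n by (simp add: funpow_swap1)
  \<comment> \<open>Applied to \<open>pderiv p\<close>, the induction hypothesis fixes the signs of
    all proper derivatives between \<open>x\<close> and \<open>y\<close>.\<close>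
  have IH: "sgn (poly ((pderiv ^^ Suc b) p) v) = sgn (poly ((pderiv ^^ Suc b) p) x)"
    if "b \<le> t" "x \<le> v" "v \<le> y" for b v
    unfolding shift[symmetric]
  proof (rule Suc.IH)
    show "(pderiv ^^ Suc t) (pderiv p) = 0" unfolding shift by (rule Suc.prems(1))
    show "sgn (poly ((pderiv ^^ a) (pderiv p)) x) = sgn (poly ((pderiv ^^ a) (pderiv p)) y)" if "a \<le> t" for a
      unfolding shift using that by (intro Suc.prems(4)) simp
  qed (use that in auto)
  have IH0: "sgn (poly (pderiv p) v) = sgn (poly (pderiv p) x)" if "x \<le> v" "v \<le> y" for v
    using IH[of 0 v] that by simp
  show ?case
  proof (cases a)
    case (Suc b)
    then show ?thesis using IH[of b u] Suc.prems by simp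
  next
    case 0
    have mono: "poly q v \<le> poly q w"
      if "\<And>v. x \<le> v \<Longrightarrow> v \<le> y \<Longrightarrow> 0 \<le> poly (pderiv q) v" "x \<le> v" "v \<le> w" "w \<le> y" for q :: "real poly" and v w
    proof (rule DERIV_nonneg_imp_nondecreasing[OF that(3)])
      fix z assume "v \<le> z" "z \<le> w"
      then have "0 \<le> poly (pderiv q) z" using that by (intro that(1)) auto
      then show "\<exists>d. (poly q has_real_derivative d) (at z) \<and> 0 \<le> d" using poly_DERIV by blast
    qed
    \<comment> \<open>Since \<open>pderiv p\<close> keeps its sign, \<open>p\<close> is monotone
      from \<open>x\<close> to \<open>y\<close>; the decreasing case is reduced to
      \<open>- p\<close>.\<close>
    have "poly p x \<le> poly p u \<and> poly p u \<le> poly p y \<or> poly p y \<le> poly p u \<and> poly p u \<le> poly p x"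
    proof (cases "0 \<le> poly (pderiv p) x")
      case True
      then have "0 \<le> poly (pderiv p) v" if "x \<le> v" "v \<le> y" for v
        using IH0[OF that] by (auto simp: sgn_if split: if_splits)
      from mono[OF this order.refl Suc.prems(2,3)] mono[OF this Suc.prems(2,3) order.refl]
      show ?thesis by simp
    next
      case False
      then have "0 \<le> poly (pderiv (- p)) v" if "x \<le> v" "v \<le> y" for v
        using IH0[OF that] by (auto simp: sgn_if pderiv_minus split: if_splits)
      from mono[OF this order.refl Suc.prems(2,3)] mono[OF this Suc.prems(2,3) order.refl]
      show ?thesis by simp
    qed
    moreover have "sgn (poly p x) = sgn (poly p y)" using Suc.prems(4)[of 0] by simp
    ultimately have "sgn (poly p u) = sgn (poly p x)" by (rule sgn_eq_between[rotated])
    then show ?thesis using 0 by simp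
  qed
qed

section \<open>Colouring triples by signs of partial derivatives\<close>

text \<open>This is the partial derivative of order \<open>(a, b, c)\<close>, expanded over the
  monomials. In this form, fixing two variables leaves a linear combination of derivatives of
  univariate monomials.\<close>

definition mixed_deriv :: "nat \<Rightarrow> nat \<Rightarrow> nat \<Rightarrow> poly3 \<Rightarrow> real \<Rightarrow> real \<Rightarrow> real \<Rightarrow> real" where
  "mixed_deriv a b c f x y z = (\<Sum>(i, j, k)\<in>Poly_Mapping.keys f. Poly_Mapping.lookup f (i, j, k) *
     poly ((pderiv ^^ a) (monom 1 i)) x * poly ((pderiv ^^ b) (monom 1 j)) y * poly ((pderiv ^^ c) (monom 1 k)) z)"

lemma mixed_deriv_0: "mixed_deriv 0 0 0 f x y z = eval3 f x y z"
  unfolding mixed_deriv_def eval3_def subst3_def by (simp add: poly_monom)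

lemma degree_keys:
  assumes "total_degree3 f \<le> t" "(i, j, k) \<in> Poly_Mapping.keys f"
  shows "i \<le> t" "j \<le> t" "k \<le> t"
proof -
  have "i + j + k \<le> total_degree3 f"
    unfolding total_degree3_def using assms(2) by (intro Max_ge) force+
  then show "i \<le> t" "j \<le> t" "k \<le> t" using assms(1) by auto
qed

text \<open>With the fixed variables absorbed into the weights \<open>w\<close>, the functions
  \<open>G a\<close> are the successive derivatives of one polynomial of degree at most
  \<open>t\<close>, to which \<open>Thom_lemma\<close> applies. The form serves all three
  coordinates alike.\<close>

lemma sgn_derivs_between:
  fixes w :: "'k \<Rightarrow> real" and e :: "'k \<Rightarrow> nat" and G :: "nat \<Rightarrow> real \<Rightarrow> real"
  assumes G: "\<And>a x. G a x = (\<Sum>\<kappa>\<in>A. w \<kappa> * poly ((pderiv ^^ a) (monom 1 (e \<kappa>))) x)"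
    and A: "finite A" "\<And>\<kappa>. \<kappa> \<in> A \<Longrightarrow> e \<kappa> \<le> t" and x: "x \<le> u" "u \<le> y"
    and sgn: "\<And>a. a \<le> t \<Longrightarrow> sgn (G a x) = sgn (G a y)" and a: "a \<le> t"
  shows "sgn (G a u) = sgn (G a x)"
proof -
  define p where "p = (\<Sum>\<kappa>\<in>A. smult (w \<kappa>) (monom 1 (e \<kappa>)))"
  have Gp: "G a x = poly ((pderiv ^^ a) p) x" for a x
    unfolding G p_def by (simp add: higher_pderiv_sum higher_pderiv_smult poly_sum)
  have "degree p \<le> t" unfolding p_def
  proof (rule degree_sum_le[OF A(1)])
    fix \<kappa> assume "\<kappa> \<in> A"
    then show "degree (smult (w \<kappa>) (monom 1 (e \<kappa>))) \<le> t"
      using A(2)[of \<kappa>] degree_smult_le[of "w \<kappa>" "monom 1 (e \<kappa>)"] degree_monom_le[of "1 :: real" "e \<kappa>"] by linarith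
  qed
  then have "(pderiv ^^ Suc t) p = 0" by (intro higher_pderiv_eq_0) simp
  from Thom_lemma[OF this x _ a] sgn show ?thesis unfolding Gp by blast
qed

text \<open>Orders up to \<open>t\<close> suffice, since higher derivatives vanish at total degree
  at most \<open>t\<close>. The restriction to these indices places the patterns in a finite
  function space.\<close>

definition sign_pattern :: "nat \<Rightarrow> (nat \<Rightarrow> poly3) \<Rightarrow> real \<Rightarrow> real \<Rightarrow> real \<Rightarrow> nat \<times> nat \<times> nat \<times> nat \<Rightarrow> real" where
  "sign_pattern t f x y z =
     (\<lambda>(l, a, b, c)\<in>{1..t} \<times> {..t} \<times> {..t} \<times> {..t}. sgn (mixed_deriv a b c (f l) x y z))"

lemma sign_pattern_eq_iff:
  "sign_pattern t f x y z = sign_pattern t f x' y' z' \<longleftrightarrow>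
    (\<forall>l\<in>{1..t}. \<forall>a\<le>t. \<forall>b\<le>t. \<forall>c\<le>t.
      sgn (mixed_deriv a b c (f l) x y z) = sgn (mixed_deriv a b c (f l) x' y' z'))"
  (is "?L \<longleftrightarrow> ?R")
proof
  assume ?L
  show ?R
  proof (intro ballI allI impI)
    fix l a b c assume "l \<in> {1..t}" "a \<le> t" "b \<le> t" "c \<le> t"
    then show "sgn (mixed_deriv a b c (f l) x y z) = sgn (mixed_deriv a b c (f l) x' y' z')"
      using fun_cong[OF \<open>?L\<close>, of "(l, a, b, c)"] by (simp add: sign_pattern_def)
  qed
next
  assume ?R
  then show ?L unfolding sign_pattern_def by (intro restrict_ext) auto
qed

text \<open>In each coordinate the other two points and the other two orders of differentiation stay
  fixed, and only the derivatives in that coordinate enter Thom's lemma.\<close>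

lemma convex_coloring3_sign_pattern:
  assumes deg: "\<And>l. l \<in> {1..t} \<Longrightarrow> total_degree3 (f l) \<le> t"
  shows "convex_coloring3 (sign_pattern t f)"
proof -
  have 1: "sgn (mixed_deriv a b c (f l) u y z) = sgn (mixed_deriv a b c (f l) x y z)"
    if l: "l \<in> {1..t}" and u: "x \<le> u" "u \<le> x'" and a: "a \<le> t"
      and sgn: "\<And>a. a \<le> t \<Longrightarrow> sgn (mixed_deriv a b c (f l) x y z) = sgn (mixed_deriv a b c (f l) x' y z)" for l a b c x y z x' u
  proof (rule sgn_derivs_between[where G = "\<lambda>a x. mixed_deriv a b c (f l) x y z", OF _ finite_keys _ u sgn a])
    show "mixed_deriv a b c (f l) x y z = (\<Sum>\<kappa>\<in>Poly_Mapping.keys (f l). (Poly_Mapping.lookup (f l) \<kappa> * poly ((pderiv ^^ b) (monom 1 (fst (snd \<kappa>)))) y *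
        poly ((pderiv ^^ c) (monom 1 (snd (snd \<kappa>)))) z) *
        poly ((pderiv ^^ a) (monom 1 (fst \<kappa>))) x)" for a x
      unfolding mixed_deriv_def case_prod_unfold by (intro sum.cong refl) (simp add: mult_ac)
    show "fst \<kappa> \<le> t" if "\<kappa> \<in> Poly_Mapping.keys (f l)" for \<kappa>
      using degree_keys[OF deg[OF l], of "fst \<kappa>" "fst (snd \<kappa>)" "snd (snd \<kappa>)"] that by simp
  qed
  have 2: "sgn (mixed_deriv a b c (f l) x u z) = sgn (mixed_deriv a b c (f l) x y z)"
    if l: "l \<in> {1..t}" and u: "y \<le> u" "u \<le> y'" and b: "b \<le> t"
      and sgn: "\<And>b. b \<le> t \<Longrightarrow> sgn (mixed_deriv a b c (f l) x y z) = sgn (mixed_deriv a b c (f l) x y' z)" for l a b c x y z y' u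
  proof (rule sgn_derivs_between[where G = "\<lambda>b y. mixed_deriv a b c (f l) x y z", OF _ finite_keys _ u sgn b])
    show "mixed_deriv a b c (f l) x y z = (\<Sum>\<kappa>\<in>Poly_Mapping.keys (f l). (Poly_Mapping.lookup (f l) \<kappa> * poly ((pderiv ^^ a) (monom 1 (fst \<kappa>))) x *
        poly ((pderiv ^^ c) (monom 1 (snd (snd \<kappa>)))) z) *
        poly ((pderiv ^^ b) (monom 1 ((fst \<circ> snd) \<kappa>))) y)" for b y
      unfolding mixed_deriv_def case_prod_unfold by (intro sum.cong refl) (simp add: mult_ac)
    show "(fst \<circ> snd) \<kappa> \<le> t" if "\<kappa> \<in> Poly_Mapping.keys (f l)" for \<kappa>
      using degree_keys[OF deg[OF l], of "fst \<kappa>" "fst (snd \<kappa>)" "snd (snd \<kappa>)"] that by simp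
  qed
  have 3: "sgn (mixed_deriv a b c (f l) x y u) = sgn (mixed_deriv a b c (f l) x y z)"
    if l: "l \<in> {1..t}" and u: "z \<le> u" "u \<le> z'" and c: "c \<le> t"
      and sgn: "\<And>c. c \<le> t \<Longrightarrow> sgn (mixed_deriv a b c (f l) x y z) = sgn (mixed_deriv a b c (f l) x y z')" for l a b c x y z z' u
  proof (rule sgn_derivs_between[where G = "\<lambda>c z. mixed_deriv a b c (f l) x y z", OF _ finite_keys _ u sgn c])
    show "mixed_deriv a b c (f l) x y z = (\<Sum>\<kappa>\<in>Poly_Mapping.keys (f l). (Poly_Mapping.lookup (f l) \<kappa> * poly ((pderiv ^^ a) (monom 1 (fst \<kappa>))) x *
        poly ((pderiv ^^ b) (monom 1 (fst (snd \<kappa>)))) y) *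
        poly ((pderiv ^^ c) (monom 1 ((snd \<circ> snd) \<kappa>))) z)" for c z
      unfolding mixed_deriv_def case_prod_unfold by (intro sum.cong refl) (simp add: mult_ac)
    show "(snd \<circ> snd) \<kappa> \<le> t" if "\<kappa> \<in> Poly_Mapping.keys (f l)" for \<kappa>
      using degree_keys[OF deg[OF l], of "fst \<kappa>" "fst (snd \<kappa>)" "snd (snd \<kappa>)"] that by simp
  qed
  show ?thesis
    unfolding convex_coloring3_def convex_coloring_def sign_pattern_eq_iff
    by (intro conjI allI ballI impI; rule 1 2 3; simp)
qed

text \<open>Its size \<open>3 ^ (t * (t + 1) ^ 3)\<close> depends on \<open>t\<close> alone and
  serves as the number of colours.\<close>

definition sign_patterns :: "nat \<Rightarrow> (nat \<times> nat \<times> nat \<times> nat \<Rightarrow> real) set" where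
  "sign_patterns t = ({1..t} \<times> {..t} \<times> {..t} \<times> {..t}) \<rightarrow>\<^sub>E {-1, 0, 1}"

lemma finite_sign_patterns: "finite (sign_patterns t)"
  unfolding sign_patterns_def by (intro finite_PiE) auto

lemma sign_pattern_in: "sign_pattern t f x y z \<in> sign_patterns t"
proof -
  have "sgn v \<in> {-1, 0, 1}" for v :: real by (simp add: sgn_real_def)
  then show ?thesis unfolding sign_pattern_def sign_patterns_def
    by (intro restrict_PiE_iff[THEN iffD2]) (auto simp del: insert_iff)
qed

text \<open>The entry of order \<open>(0, 0, 0)\<close> is the sign of \<open>f l\<close> itself,
  and a real number is nonnegative exactly when its sign is. Thus, on increasing triples, the
  relation is a union of colour classes.\<close>

lemma semialg3_iff_sign_pattern:
  assumes "x < y" "y < z"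
  shows "(x, y, z) \<in> semialg3 t f \<Phi> \<longleftrightarrow>
    sign_pattern t f x y z \<in> {\<phi>. \<Phi> (map (\<lambda>l. \<phi> (l, 0, 0, 0) \<ge> 0) [1..<t + 1])}"
proof -
  have "map (\<lambda>l. sign_pattern t f x y z (l, 0, 0, 0) \<ge> 0) [1..<t + 1] = map (\<lambda>l. eval3 (f l) x y z \<ge> 0) [1..<t + 1]"
    by (intro map_cong refl) (auto simp: sign_pattern_def mixed_deriv_0)
  then show ?thesis using assms
    unfolding semialg3_def mem_Collect_eq prod.case by (simp only: simp_thms)
qed

theorem theorem10:
  fixes t :: nat
  assumes "t \<ge> 1"
  shows "\<exists>\<epsilon> \<alpha> :: real. 0 < \<epsilon> \<and> \<epsilon> < 1 \<and> 0 < \<alpha> \<and> \<alpha> < 1 \<and>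
    (\<forall>(N::nat) (r::nat) (s::nat) (p::nat \<Rightarrow> real) (f::nat \<Rightarrow> poly3) (\<Phi>::bool list \<Rightarrow> bool)
        (E::(real \<times> real \<times> real) set).
      N \<ge> 1 \<longrightarrow>
      strict_mono_on {1..N} p \<longrightarrow>
      semialgebraic_relation t f \<Phi> (p ` {1..N}) E \<longrightarrow>
      at_most_roots_in_domain t f N p r \<longrightarrow>
      K3_free (p ` {1..N}) E s \<longrightarrow>
      (\<exists>P' \<subseteq> p ` {1..N}. triples P' \<inter> E = {} \<and>
         real (card P') \<ge> exp (\<alpha> powr (\<epsilon> * (real r + real s)) * (ln (real N)) powr \<epsilon>)))"
proof -
  let ?\<chi> = "sign_pattern t"
  let ?C0 = "\<lambda>\<Phi>. {\<phi>. \<Phi> (map (\<lambda>l. \<phi> (l, 0, 0, 0) \<ge> 0) [1..<t + 1])} :: (nat \<times> nat \<times> nat \<times> nat \<Rightarrow> real) set"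
  \<comment> \<open>The constants are fixed from the number of sign patterns before
    \<open>N\<close>, \<open>p\<close>, \<open>f\<close>, \<open>\<Phi>\<close> and \<open>E\<close>
    appear, so they depend only on \<open>t\<close>.\<close>
  obtain \<epsilon> \<alpha> :: real where \<epsilon>\<alpha>: "0 < \<epsilon>" "\<epsilon> < 1" "0 < \<alpha>" "\<alpha> < 1"
    and large: "\<forall>(\<chi> :: real \<Rightarrow> real \<Rightarrow> real \<Rightarrow> nat \<times> nat \<times> nat \<times> nat \<Rightarrow> real) C C0 s X.
      convex_coloring3 \<chi> \<longrightarrow> finite C \<longrightarrow> card C \<le> card (sign_patterns t) \<longrightarrow> (\<forall>x y z. \<chi> x y z \<in> C) \<longrightarrow>
      finite X \<longrightarrow> X \<noteq> {} \<longrightarrow> clique_free3 (\<lambda>x y z. \<chi> x y z \<in> C0) X s \<longrightarrow>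
      (\<exists>P\<subseteq>X. independent_set3 (\<lambda>x y z. \<chi> x y z \<in> C0) P \<and>
        exp (\<alpha> powr (\<epsilon> * real s) * ln (real (card X)) powr \<epsilon>) \<le> real (card P))"
    using large_independent_set[of "card (sign_patterns t)"] by (elim exE conjE) (rule that)
  have main: "\<exists>P' \<subseteq> p ` {1..N}. triples P' \<inter> E = {} \<and>
      real (card P') \<ge> exp (\<alpha> powr (\<epsilon> * (real r + real s)) * (ln (real N)) powr \<epsilon>)"
    if N: "N \<ge> 1" and p: "strict_mono_on {1..N} p" and E: "semialgebraic_relation t f \<Phi> (p ` {1..N}) E"
      and free: "K3_free (p ` {1..N}) E s" for N r s p f \<Phi> E
  proof -
    let ?X = "p ` {1..N}"
    have inE: "(x, y, z) \<in> E \<longleftrightarrow> ?\<chi> f x y z \<in> ?C0 \<Phi>" if "(x, y, z) \<in> triples ?X" for x y z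
    proof -
      have "x < y" "y < z" using that unfolding triples_def by auto
      then show ?thesis using E that semialg3_iff_sign_pattern[of x y z t f \<Phi>]
        unfolding semialgebraic_relation_def by blast
    qed
    have "clique_free3 (\<lambda>x y z. ?\<chi> f x y z \<in> ?C0 \<Phi>) ?X s"
      unfolding clique_free3_def
    proof (intro allI impI)
      fix T assume T: "T \<subseteq> ?X" "card T = s"
      then obtain \<tau> where \<tau>: "\<tau> \<in> triples T" "\<tau> \<notin> E" using free unfolding K3_free_def by blast
      obtain x y z where xyz: "\<tau> = (x, y, z)" by (cases \<tau>)
      have "(x, y, z) \<in> triples ?X" using \<tau>(1) T(1) unfolding xyz triples_def by auto
      from inE[OF this] \<tau> show "\<exists>x\<in>T. \<exists>y\<in>T. \<exists>z\<in>T. x < y \<and> y < z \<and> ?\<chi> f x y z \<notin> ?C0 \<Phi>"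
        unfolding xyz triples_def by blast
    qed
    moreover have "convex_coloring3 (?\<chi> f)"
      using E unfolding semialgebraic_relation_def by (intro convex_coloring3_sign_pattern) blast
    moreover have "?X \<noteq> {}" using N by simp
    ultimately obtain P where P: "P \<subseteq> ?X" "independent_set3 (\<lambda>x y z. ?\<chi> f x y z \<in> ?C0 \<Phi>) P"
      "exp (\<alpha> powr (\<epsilon> * real s) * ln (real (card ?X)) powr \<epsilon>) \<le> real (card P)"
      using large[rule_format, of "?\<chi> f" "sign_patterns t" ?X "?C0 \<Phi>" s] finite_sign_patterns sign_pattern_in by blast
    have cX: "card ?X = N" using card_image[OF strict_mono_on_imp_inj_on[OF p]] by simp
    have "triples P \<inter> E = {}"
    proof (intro equals0I)
      fix \<tau> assume \<tau>: "\<tau> \<in> triples P \<inter> E"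
      obtain x y z where xyz: "\<tau> = (x, y, z)" by (cases \<tau>)
      have "(x, y, z) \<in> triples ?X" using \<tau> P(1) unfolding xyz triples_def by auto
      from inE[OF this] \<tau> P(2) show False unfolding xyz triples_def by (auto dest: independent_set3D)
    qed
    moreover have "\<alpha> powr (\<epsilon> * (real r + real s)) \<le> \<alpha> powr (\<epsilon> * real s)"
      using \<epsilon>\<alpha> by (intro powr_mono') auto
    then have "exp (\<alpha> powr (\<epsilon> * (real r + real s)) * ln (real N) powr \<epsilon>)
        \<le> exp (\<alpha> powr (\<epsilon> * real s) * ln (real (card ?X)) powr \<epsilon>)"
      unfolding cX by (simp add: mult_right_mono)
    ultimately show ?thesis using P by (intro exI[of _ P]) linarith
  qed
  show ?thesis
    by (rule exI[of _ \<epsilon>], rule exI[of _ \<alpha>], intro conjI \<epsilon>\<alpha> allI impI) (rule main)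
qed

end
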